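(* Let $(\Omega,\mathcal F,(\mathcal F_t)_{t=0}^T,P)$ be a complete filtered probability space, let $n=n_0+\cdots+n_T$, let $\mathcal N:=\{(x_t)_{t=0}^T\mid x_t\in L^0(\Omega,\mathcal F_t,P;\mathbb R^{n_t})\}$, and let $h:\mathbb R^n\times\Omega\to\overline{\mathbb R}$ be an $\mathcal F$-normal integrand such that $h\ge m$ for some $m\in L^1(\Omega,\mathcal F,P)$. Assume that there is a measurable set-valued mapping $N:\Omega\rightrightarrows\mathbb R^n$ such that $N(\omega)$ is a linear subspace of $\mathbb R^n$ for each $\omega$, $$\{x\in\mathcal N\mid h^\infty(x)\le0\ \text{a.s.}\}=\{x\in\mathcal N\mid x\in N\ \text{a.s.}\},$$ and that $Eh(x+x')=Eh(x)$ for all $x,x'\in\mathcal N$ with $x'\in N$ almost surely. Then the problem $$\text{minimize}\quad Eh(x):=\int h(x(\omega),\omega)\,dP(\omega)\quad\text{over }x\in\mathcal N$$ has an optimal solution, i.e. there exists $\bar x\in\mathcal N$ with $Eh(\bar x)=\inf_{x\in\mathcal N}Eh(x)$.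
   Context: An $\mathcal F$-normal integrand on $\mathbb R^n\times\Omega$ is an extended real-valued $\mathcal B(\mathbb R^n)\otimes\mathcal F$-measurable function $h$ such that $h(\cdot,\omega)$ is lower semicontinuous for every $\omega$; properties of normal integrands and inequalities between random variables are understood $P$-almost surely. Horizon function: for $g:\mathbb R^n\to\overline{\mathbb R}$, $$g^\infty(w):=\lim_{\delta\searrow0}\ \inf_{\lambda\in(0,\delta),\ w'\in\mathbb B(w,\delta)}\lambda g(w'/\lambda),$$ where $\mathbb B(w,\delta)$ is the closed ball of radius $\delta$ around $w$. $h^\infty(\cdot,\omega)$ is the horizon function of $h(\cdot,\omega)$, and $h^\infty(x)$ denotes the random variable $\omega\mapsto h^\infty(x(\omega),\omega)$. A set-valued mapping $N:\Omega\rightrightarrows\mathbb R^n$ is measurable if $\{\omega\in\Omega\mid N(\omega)\cap O\neq\emptyset\}\in\mathcal F$ for every open $O\subset\mathbb R^n$. *)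

theory Defs
  imports "HOL-Probability.Probability"
begin

text \<open>
  Completeness of the filtered space: \<open>M\<close> is complete and the initial \<open>\<sigma>\<close>-algebra contains
  all \<open>M\<close>-null sets. Only the times \<open>0, \<dots>, T\<close> are constrained.
\<close>

locale complete_filtered_prob_space = prob_space M + complete_measure M
  for M :: "'a measure" +
  fixes F :: "nat \<Rightarrow> 'a measure" and T :: nat
  assumes subalgebra_F: "t \<le> T \<Longrightarrow> subalgebra M (F t)"
    and sets_F_mono: "s \<le> t \<Longrightarrow> t \<le> T \<Longrightarrow> sets (F s) \<subseteq> sets (F t)"
    and null_sets_F: "null_sets M \<subseteq> sets (F 0)"

text \<open>
  The decomposition \<open>n = n\<^sub>0 + \<dots> + n\<^sub>T\<close> of the coordinates is encoded by a map
  \<open>stage\<close> on the index type of \<open>\<real>\<^sup>n\<close>: the coordinates making up the block \<open>x\<^sub>t\<close> are those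
  with \<open>stage i = t\<close>, and \<open>n\<^sub>t\<close> is their number.
\<close>

definition block_decomposition :: "nat \<Rightarrow> (nat \<Rightarrow> nat) \<Rightarrow> ('n::finite \<Rightarrow> nat) \<Rightarrow> bool" where
  "block_decomposition T n stage \<longleftrightarrow>
     (\<forall>i. stage i \<le> T) \<and> (\<forall>t\<le>T. card {i. stage i = t} = n t)"

lemma block_decomposition_dim:
  fixes stage :: "'n::finite \<Rightarrow> nat"
  assumes "block_decomposition T n stage"
  shows "DIM(real ^ 'n) = (\<Sum>t\<le>T. n t)"
proof -
  have "card (UNIV :: 'n set) = card (\<Union>t\<in>{..T}. {i. stage i = t})"
    using assms by (intro arg_cong[where f = card]) (auto simp: block_decomposition_def)
  also have "\<dots> = (\<Sum>t\<le>T. card {i. stage i = t})"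
    by (rule card_UN_disjoint) auto
  also have "\<dots> = (\<Sum>t\<le>T. n t)"
    using assms by (intro sum.cong) (auto simp: block_decomposition_def)
  finally show ?thesis by simp
qed

text \<open>
  Strategies are genuine functions rather than equivalence classes; everything below depends
  on them only up to null sets.
\<close>

definition adapted_strategies ::
    "(nat \<Rightarrow> 'a measure) \<Rightarrow> ('n::finite \<Rightarrow> nat) \<Rightarrow> ('a \<Rightarrow> real ^ 'n) set" where
  "adapted_strategies F stage = {x. \<forall>i. (\<lambda>\<omega>. x \<omega> $ i) \<in> borel_measurable (F (stage i))}"

definition lower_semicontinuous :: "('b::topological_space \<Rightarrow> ereal) \<Rightarrow> bool" where
  "lower_semicontinuous g \<longleftrightarrow> (\<forall>x. g x \<le> Liminf (at x) g)"

definition normal_integrand ::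
    "'a measure \<Rightarrow> ('b::euclidean_space \<Rightarrow> 'a \<Rightarrow> ereal) \<Rightarrow> bool" where
  "normal_integrand M h \<longleftrightarrow>
     (\<lambda>(x, \<omega>). h x \<omega>) \<in> borel_measurable (borel \<Otimes>\<^sub>M M) \<and>
     (\<forall>\<omega>\<in>space M. lower_semicontinuous (\<lambda>x. h x \<omega>))"

definition horizon :: "('b::real_normed_vector \<Rightarrow> ereal) \<Rightarrow> 'b \<Rightarrow> ereal" where
  "horizon g w =
     Lim (at_right 0)
       (\<lambda>\<delta>::real. INF (l, w') \<in> {0<..<\<delta>} \<times> cball w \<delta>. ereal l * g (w' /\<^sub>R l))"

text \<open>The limit in the definition always exists, so that \<^const>\<open>Lim\<close> is well-defined:\<close>

lemma tendsto_horizon: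
  "((\<lambda>\<delta>::real. INF (l, w') \<in> {0<..<\<delta>} \<times> cball w \<delta>. ereal l * g (w' /\<^sub>R l))
     \<longlongrightarrow> horizon g w) (at_right 0)"
proof -
  define f where
    "f = (\<lambda>\<delta>::real. INF (l, w') \<in> {0<..<\<delta>} \<times> cball w \<delta>. ereal l * g (w' /\<^sub>R l))"
  have anti: "f b \<le> f a" if "a \<le> b" for a b
    unfolding f_def using that by (intro INF_superset_mono) auto
  have "(f \<longlongrightarrow> (SUP \<delta>\<in>{0<..}. f \<delta>)) (at_right 0)"
  proof (rule increasing_tendsto)
    show "\<forall>\<^sub>F \<delta> in at_right 0. f \<delta> \<le> (SUP \<delta>\<in>{0<..}. f \<delta>)"
      using eventually_at_right_less[of 0] by eventually_elim (auto intro: SUP_upper)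
  next
    fix y assume "y < (SUP \<delta>\<in>{0<..}. f \<delta>)"
    then obtain d where d: "d > 0" "y < f d"
      by (auto simp: less_SUP_iff)
    show "\<forall>\<^sub>F \<delta> in at_right 0. y < f \<delta>"
      unfolding eventually_at_right_field
      using d anti by (intro exI[of _ d]) (auto intro: less_le_trans)
  qed
  moreover from this have "Lim (at_right 0) f = (SUP \<delta>\<in>{0<..}. f \<delta>)"
    by (intro tendsto_Lim) simp_all
  ultimately have "(f \<longlongrightarrow> Lim (at_right 0) f) (at_right 0)"
    by simp
  then show ?thesis
    unfolding horizon_def f_def by simp
qed

text \<open>
  \<open>E f = E f\<^sup>+ - E f\<^sup>-\<close>; note that \<^const>\<open>e2ennreal\<close> truncates negative values to \<open>0\<close>
  and that \<open>\<infinity> - \<infinity> = \<infinity>\<close> in \<^typ>\<open>ereal\<close>. The latter never matters for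
  integrands with an integrable lower bound.
\<close>

definition ereal_expectation :: "'a measure \<Rightarrow> ('a \<Rightarrow> ereal) \<Rightarrow> ereal" where
  "ereal_expectation M f =
     enn2ereal (\<integral>\<^sup>+\<omega>. e2ennreal (f \<omega>) \<partial>M) - enn2ereal (\<integral>\<^sup>+\<omega>. e2ennreal (- f \<omega>) \<partial>M)"

definition integral_functional ::
    "'a measure \<Rightarrow> ('b \<Rightarrow> 'a \<Rightarrow> ereal) \<Rightarrow> ('a \<Rightarrow> 'b) \<Rightarrow> ereal" where
  "integral_functional M h x = ereal_expectation M (\<lambda>\<omega>. h (x \<omega>) \<omega>)"

definition measurable_set_valued ::
    "'a measure \<Rightarrow> ('a \<Rightarrow> 'b::topological_space set) \<Rightarrow> bool" where
  "measurable_set_valued M N \<longleftrightarrow>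
     (\<forall>U. open U \<longrightarrow> {\<omega> \<in> space M. N \<omega> \<inter> U \<noteq> {}} \<in> sets M)"

end

theory Submission
  imports Defs
begin

text \<open>
  Existence without convexity cannot use convex combinations, so minimizing sequences are handled
  by random subsequences. Proceeding backwards over the coordinates, ordered by stage, one
  extracts at the coordinate of rank \<open>i\<close> a \<open>G i\<close>-measurable random subsequence along which both
  the conditional cost and the coordinate converge in the extended reals. Where the coordinate
  stays bounded, conditional Fatou and the claim for rank \<open>i + 1\<close> give the limit strategy. Where it
  is unbounded, rescaling gives an adapted \<open>w\<close> with \<open>h\<^sup>\<infinity>(w) \<le> 0\<close>, zero in the earlier coordinates and
  equal to \<open>1\<close> or \<open>-1\<close> in this one. So \<open>w \<in> N\<close>, and by invariance of the cost along \<open>N\<close> the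
  coordinate could have been made zero beforehand on the largest set carrying such a direction;
  hence the unbounded case has probability zero.
\<close>

section \<open>Conditional expectations and random subsequences\<close>

text \<open>Conditional rather than pathwise costs are made to converge, because an index chosen at
  rank \<open>i\<close> may depend on \<omega> only through \<open>G i\<close>. The later
  coordinates of the selected strategies need not converge along that subsequence; the claim for
  rank \<open>i + 1\<close> extracts further from it, and the bound it yields is conditioned down
  from \<open>G (i + 1)\<close> to \<open>G i\<close>. Working with scalars instead of stage blocks
  reduces compactness to that of the extended reals and leaves only two limits, \<open>1\<close> and
  \<open>-1\<close>, in the unbounded case. The order inside a stage is arbitrary, since these
  coordinates share one \<sigma>-algebra. Linearity of \<open>N\<close> enters in two places: a
  limit \<open>-1\<close> may be reversed to \<open>1\<close>, and a direction with entry
  \<open>1\<close> at a coordinate may be multiplied by any real, known at that rank, to cancel that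
  coordinate. The unbounded event and the maximal set of directions are then disjoint, because a
  cancelled coordinate is constantly zero.\<close>

lemma borel_measurable_vec_components:
  fixes x :: "'a \<Rightarrow> real ^ 'n::finite"
  assumes "\<And>c. (\<lambda>\<omega>. x \<omega> $ c) \<in> borel_measurable L"
  shows "x \<in> borel_measurable L"
  using assms by (subst borel_measurable_euclidean_space) (auto simp: Basis_vec_def inner_axis)

context sigma_finite_subalgebra
begin

lemma measurable_F_imp: "f \<in> measurable F N \<Longrightarrow> f \<in> measurable M N"
  using measurable_from_subalg[OF subalg] .

lemma nn_cond_exp_set_integral:
  assumes "A \<in> sets F" and "f \<in> borel_measurable M"
  shows "(\<integral>\<^sup>+x\<in>A. nn_cond_exp M F f x \<partial>M) = (\<integral>\<^sup>+x\<in>A. f x \<partial>M)"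
  using nn_cond_exp_intg[of "indicator A" f] assms by (simp add: mult.commute)

lemma nn_cond_exp_local:
  assumes B: "B \<in> sets F" and eq: "AE x in M. x \<in> B \<longrightarrow> f x = g x"
    and [measurable]: "f \<in> borel_measurable M" "g \<in> borel_measurable M"
  shows "AE x in M. x \<in> B \<longrightarrow> nn_cond_exp M F f x = nn_cond_exp M F g x"
proof -
  have [measurable]: "B \<in> sets M" using B subalg by (auto simp: subalgebra_def)
  have [measurable]: "(indicator B :: _ \<Rightarrow> ennreal) \<in> borel_measurable F" using B by simp
  have "AE x in M. indicator B x * f x = indicator B x * g x"
    using eq by eventually_elim (auto simp: indicator_def)
  then have "AE x in M. nn_cond_exp M F (\<lambda>x. indicator B x * f x) x =
      nn_cond_exp M F (\<lambda>x. indicator B x * g x) x"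
    by (rule nn_cond_exp_cong) auto
  moreover have "AE x in M. indicator B x * nn_cond_exp M F f x = nn_cond_exp M F (\<lambda>x. indicator B x * f x) x"
    by (rule nn_cond_exp_prod) auto
  moreover have "AE x in M. indicator B x * nn_cond_exp M F g x = nn_cond_exp M F (\<lambda>x. indicator B x * g x) x"
    by (rule nn_cond_exp_prod) auto
  ultimately show ?thesis by eventually_elim (auto simp: indicator_def)
qed

text \<open>An index known in \<open>F\<close> is constant on each of countably many
  \<open>F\<close>-events, and conditional expectation is local on such events. Conditional costs of
  random subsequences are thus read off from those of their members.\<close>

lemma nn_cond_exp_piecewise:
  fixes J :: "'a \<Rightarrow> nat"
  assumes J: "J \<in> measurable F (count_space UNIV)" and f: "\<And>j. f j \<in> borel_measurable M"
  shows "AE x in M. nn_cond_exp M F (\<lambda>x. f (J x) x) x = nn_cond_exp M F (f (J x)) x"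
proof -
  have JM: "J \<in> measurable M (count_space UNIV)" using J by (rule measurable_F_imp)
  have *: "AE x in M. x \<in> J -` {j} \<inter> space F \<longrightarrow> nn_cond_exp M F (\<lambda>x. f (J x) x) x = nn_cond_exp M F (f j) x" for j
  proof (rule nn_cond_exp_local)
    show "J -` {j} \<inter> space F \<in> sets F" using J by (rule measurable_sets) auto
    show "(\<lambda>x. f (J x) x) \<in> borel_measurable M"
      by (rule measurable_compose_countable[OF f JM])
  qed (use f in auto)
  have "AE x in M. \<forall>j. x \<in> J -` {j} \<inter> space F \<longrightarrow> nn_cond_exp M F (\<lambda>x. f (J x) x) x = nn_cond_exp M F (f j) x"
    using * by (simp only: AE_all_countable) blast
  with AE_space show ?thesis
    by eventually_elim (use subalg in \<open>auto simp: subalgebra_def\<close>)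
qed

lemma nn_cond_exp_SUP:
  assumes f[measurable]: "\<And>k. f k \<in> borel_measurable M" and inc: "\<And>x. incseq (\<lambda>k::nat. f k x)"
  shows "AE x in M. nn_cond_exp M F (\<lambda>x. SUP k. f k x) x = (SUP k. nn_cond_exp M F (f k) x)"
proof -
  have mono: "AE x in M. \<forall>k. nn_cond_exp M F (f k) x \<le> nn_cond_exp M F (f (Suc k)) x"
    unfolding AE_all_countable
    by (intro allI nn_cond_exp_mono) (use inc in \<open>auto simp: incseq_Suc_iff\<close>)
  have "AE x in M. (SUP k. nn_cond_exp M F (f k) x) = nn_cond_exp M F (\<lambda>x. SUP k. f k x) x"
  proof (rule nn_cond_exp_charact)
    fix A assume A: "A \<in> sets F"
    then have [measurable]: "A \<in> sets M" using subalg by (auto simp: subalgebra_def)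
    have "(\<integral>\<^sup>+x\<in>A. (SUP k. f k x) \<partial>M) = (\<integral>\<^sup>+x. (SUP k. f k x * indicator A x) \<partial>M)"
      by (simp add: SUP_mult_right_ennreal)
    also have "\<dots> = (SUP k. \<integral>\<^sup>+x\<in>A. f k x \<partial>M)"
      by (rule nn_integral_monotone_convergence_SUP)
        (use inc in \<open>auto simp: incseq_def le_fun_def intro!: mult_right_mono\<close>)
    also have "\<dots> = (SUP k. \<integral>\<^sup>+x\<in>A. nn_cond_exp M F (f k) x \<partial>M)"
      using A by (simp add: nn_cond_exp_set_integral)
    also have "\<dots> = (\<integral>\<^sup>+x. (SUP k. nn_cond_exp M F (f k) x * indicator A x) \<partial>M)"
      by (rule nn_integral_monotone_convergence_SUP_AE[symmetric])
        (use mono in \<open>auto intro!: mult_right_mono\<close>)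
    also have "\<dots> = (\<integral>\<^sup>+x\<in>A. (SUP k. nn_cond_exp M F (f k) x) \<partial>M)"
      by (simp add: SUP_mult_right_ennreal)
    finally show "(\<integral>\<^sup>+x\<in>A. (SUP k. f k x) \<partial>M) = (\<integral>\<^sup>+x\<in>A. (SUP k. nn_cond_exp M F (f k) x) \<partial>M)" .
  qed auto
  then show ?thesis by (auto simp: eq_commute)
qed

lemma nn_cond_exp_Fatou:
  assumes [measurable]: "\<And>k. f k \<in> borel_measurable M"
  shows "AE x in M. nn_cond_exp M F (\<lambda>x. liminf (\<lambda>k. f k x)) x \<le> liminf (\<lambda>k. nn_cond_exp M F (f k) x)"
proof -
  have "AE x in M. \<forall>k. \<forall>m\<in>{k..}. nn_cond_exp M F (\<lambda>x. INF m\<in>{k..}. f m x) x \<le> nn_cond_exp M F (f m) x"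
    unfolding AE_all_countable
    by (intro allI AE_ball_countable[THEN iffD2] ballI nn_cond_exp_mono) (auto intro!: INF_lower)
  moreover have "AE x in M. nn_cond_exp M F (\<lambda>x. SUP k. INF m\<in>{k..}. f m x) x =
      (SUP k. nn_cond_exp M F (\<lambda>x. INF m\<in>{k..}. f m x) x)"
    by (rule nn_cond_exp_SUP) (auto simp: incseq_def intro!: INF_superset_mono)
  ultimately show ?thesis
    unfolding liminf_SUP_INF
    by eventually_elim (auto intro!: SUP_mono INF_greatest)
qed

end

text \<open>Descends from \<open>G'\<close> to \<open>G\<close> in the backward induction:
  \<open>D\<close> and the weights \<open>l k\<close> are already \<open>G\<close>-measurable and
  come out of the conditional expectation, Fatou handles the lower limit, and the tower property
  removes the inner conditioning.\<close>

lemma nn_cond_exp_tower_liminf: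
  assumes G: "sigma_finite_subalgebra M G" and G': "sigma_finite_subalgebra M G'"
    and sub: "subalgebra G' G"
    and D: "D \<in> sets G" and \<phi>[measurable]: "\<phi> \<in> borel_measurable M"
    and f[measurable]: "\<And>k. f k \<in> borel_measurable M" and l: "\<And>k. l k \<in> borel_measurable G"
    and le: "AE x in M. x \<in> D \<longrightarrow> nn_cond_exp M G' \<phi> x \<le> liminf (\<lambda>k. l k x * nn_cond_exp M G' (f k) x)"
  shows "AE x in M. x \<in> D \<longrightarrow> nn_cond_exp M G \<phi> x \<le> liminf (\<lambda>k. l k x * nn_cond_exp M G (f k) x)"
proof -
  interpret G: sigma_finite_subalgebra M G by fact
  interpret G': sigma_finite_subalgebra M G' by fact
  note [measurable] = G.measurable_F_imp[OF l]
  have [measurable]: "D \<in> sets M" using D G.subalg by (auto simp: subalgebra_def)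
  have l': "l k \<in> borel_measurable G'" for k using l sub by (rule measurable_from_subalg[rotated])
  have 1: "AE x in M. nn_cond_exp M G (\<lambda>x. indicator D x * nn_cond_exp M G' \<phi> x) x
      \<le> nn_cond_exp M G (\<lambda>x. liminf (\<lambda>k. l k x * nn_cond_exp M G' (f k) x)) x"
    by (rule G.nn_cond_exp_mono) (use le in \<open>auto simp: indicator_def\<close>)
  have 2: "AE x in M. indicator D x * nn_cond_exp M G (nn_cond_exp M G' \<phi>) x =
        nn_cond_exp M G (\<lambda>x. indicator D x * nn_cond_exp M G' \<phi> x) x"
    by (rule G.nn_cond_exp_prod) (use D in auto)
  have 3: "AE x in M. nn_cond_exp M G \<phi> x = nn_cond_exp M G (nn_cond_exp M G' \<phi>) x"
    by (rule G.nn_cond_exp_nested_subalg) (use G'.subalg sub in auto)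
  have 4: "AE x in M. nn_cond_exp M G (\<lambda>x. liminf (\<lambda>k. l k x * nn_cond_exp M G' (f k) x)) x \<le>
      liminf (\<lambda>k. nn_cond_exp M G (\<lambda>x. l k x * nn_cond_exp M G' (f k) x) x)"
    by (rule G.nn_cond_exp_Fatou) auto
  have 5: "AE x in M. \<forall>k. l k x * nn_cond_exp M G (nn_cond_exp M G' (f k)) x
      = nn_cond_exp M G (\<lambda>x. l k x * nn_cond_exp M G' (f k) x) x"
    unfolding AE_all_countable by (intro allI G.nn_cond_exp_prod l) auto
  have 6: "AE x in M. \<forall>k. nn_cond_exp M G (f k) x = nn_cond_exp M G (nn_cond_exp M G' (f k)) x"
    unfolding AE_all_countable
    by (intro allI G.nn_cond_exp_nested_subalg) (use G'.subalg sub in auto)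
  show ?thesis using 1 2 3 4 5 6
    by eventually_elim (auto simp: indicator_def)
qed

section \<open>Measurable random subsequences that realise a lower limit\<close>

lemma frequently_near_liminf:
  fixes f :: "nat \<Rightarrow> 'b::{complete_linorder, linorder_topology}"
  assumes "open S" "liminf f \<in> S"
  shows "\<exists>j\<ge>m. f j \<in> S"
proof (rule ccontr)
  assume *: "\<not> (\<exists>j\<ge>m. f j \<in> S)"
  define L where "L = liminf f"
  show False
  \<comment> \<open>\<open>L\<close> may be an endpoint of the order, so a one-sided neighbourhood
    is available only where something lies on that side. Below a larger \<open>b\<close>, the values
    eventually avoid the neighbourhood and everything under \<open>L\<close>, hence stay above
    \<open>b\<close>, which would push the lower limit up to \<open>b\<close>.\<close>
  proof (cases "\<exists>b. L < b")
    case True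
    then obtain b where "L < b" "{L..<b} \<subseteq> S"
      using open_right[of S L] assms by (auto simp: L_def)
    have *: "\<forall>\<^sub>F j in sequentially. f j < L \<or> b \<le> f j"
      using * \<open>{L..<b} \<subseteq> S\<close> unfolding eventually_sequentially
      by (intro exI[of _ m]) (metis atLeastLessThan_iff not_less subset_iff)
    have "\<forall>\<^sub>F j in sequentially. b \<le> f j"
    proof (cases "\<exists>a. a < L")
      case True
      then obtain a where a: "a < L" "{a<..L} \<subseteq> S"
        using open_left[of S L] assms by (auto simp: L_def)
      have "\<forall>\<^sub>F j in sequentially. a < f j"
        using le_Liminf_iff[of L sequentially f] a by (auto simp: L_def)
      moreover have "\<forall>\<^sub>F j in sequentially. j \<ge> m" by simp
      ultimately show ?thesis using *
      proof eventually_elim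
        case (elim j)
        with a \<open>\<not> (\<exists>j\<ge>m. f j \<in> S)\<close> show ?case by force
      qed
    next
      case False
      show ?thesis using * by eventually_elim (use False in blast)
    qed
    then have "b \<le> L" unfolding L_def by (rule Liminf_bounded)
    with \<open>L < b\<close> show False by simp
  next
    case False
    then have top: "x \<le> L" for x by (simp add: not_less)
    show False
    proof (cases "\<exists>a. a < L")
      case True
      then obtain a where a: "a < L" "{a<..L} \<subseteq> S"
        using open_left[of S L] assms by (auto simp: L_def)
      have "\<forall>\<^sub>F j in sequentially. a < f j"
        using le_Liminf_iff[of L sequentially f] a by (auto simp: L_def)
      then obtain k where "\<And>j. j \<ge> k \<Longrightarrow> a < f j" by (auto simp: eventually_sequentially)
      then have "f (max k m) \<in> S" using a top by auto
      with * show False by auto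
    next
      case False
      then have "f m = L" using top[of "f m"] by (auto simp: not_less intro: antisym)
      with * assms show False by (auto simp: L_def)
    qed
  qed
qed

text \<open>Taking the least admissible index beyond the previous one makes the choice canonical,
  and a least index over measurable predicates is measurable.\<close>

lemma measurable_random_indices:
  fixes Q :: "nat \<Rightarrow> nat \<Rightarrow> 'a \<Rightarrow> bool"
  assumes meas: "\<And>k j. Measurable.pred G (Q k j)"
    and freq: "\<And>k m x. x \<in> space G \<Longrightarrow> \<exists>j\<ge>m. Q k j x"
  obtains \<tau> :: "nat \<Rightarrow> 'a \<Rightarrow> nat" where "\<And>k. \<tau> k \<in> measurable G (count_space UNIV)"
    "\<And>x. x \<in> space G \<Longrightarrow> strict_mono (\<lambda>k. \<tau> k x)"
    "\<And>k x. x \<in> space G \<Longrightarrow> Q k (\<tau> k x) x"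
proof -
  define \<tau> where "\<tau> = rec_nat (\<lambda>x. LEAST j. Q 0 j x) (\<lambda>k t x. LEAST j. t x < j \<and> Q (Suc k) j x)"
  have Z: "\<tau> 0 = (\<lambda>x. LEAST j. Q 0 j x)" and S: "\<tau> (Suc k) = (\<lambda>x. LEAST j. \<tau> k x < j \<and> Q (Suc k) j x)" for k
    by (simp_all add: \<tau>_def)
  note [measurable] = meas
  have m: "\<tau> k \<in> measurable G (count_space UNIV)" for k
  proof (induction k)
    case 0
    show ?case unfolding Z by measurable
  next
    case (Suc k)
    note [measurable] = Suc
    show ?case unfolding S by measurable
  qed
  have s: "\<tau> k x < \<tau> (Suc k) x \<and> Q (Suc k) (\<tau> (Suc k) x) x" if "x \<in> space G" for k x
    unfolding S using freq[OF that, of "Suc (\<tau> k x)" "Suc k"]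
    by (metis (mono_tags, lifting) LeastI Suc_le_eq)
  have q: "Q k (\<tau> k x) x" if "x \<in> space G" for k x
  proof (cases k)
    case 0
    then show ?thesis unfolding 0 Z using freq[OF that, of 0 0] by (auto intro: LeastI)
  qed (use s[OF that] in auto)
  show thesis using that[OF m _ q] s by (auto simp: strict_mono_Suc_iff)
qed

lemma measurable_subsequence_liminf:
  fixes f :: "nat \<Rightarrow> 'a \<Rightarrow> 'b::{complete_linorder, linorder_topology, second_countable_topology}"
  assumes [measurable]: "\<And>k. f k \<in> borel_measurable G"
  obtains \<tau> :: "nat \<Rightarrow> 'a \<Rightarrow> nat" where "\<And>k. \<tau> k \<in> measurable G (count_space UNIV)"
    "\<And>x. x \<in> space G \<Longrightarrow> strict_mono (\<lambda>k. \<tau> k x)"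
    "\<And>x. x \<in> space G \<Longrightarrow> (\<lambda>k. f (\<tau> k x) x) \<longlonglongrightarrow> liminf (\<lambda>k. f k x)"
proof -
  obtain B :: "'b set set" where B: "countable B" "topological_basis B"
    using ex_countable_basis by auto
  have "B \<noteq> {}" using B(2) by (metis UNIV_I empty_iff open_UNIV topological_basisE)
  define b where "b = from_nat_into B"
  have b: "range b = B" using B \<open>B \<noteq> {}\<close> by (simp add: b_def)
  have op[measurable]: "open (b i)" for i using b B topological_basis_open by blast
  have bm[measurable]: "b i \<in> sets borel" for i using op by simp
  \<comment> \<open>Index \<open>j\<close> is admissible at step \<open>k\<close> if
    \<open>f j x\<close> lies in every neighbourhood of the lower limit among the first
    \<open>k + 1\<close> basic sets. Their intersection is open, so such \<open>j\<close> occur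
    arbitrarily late; each basic neighbourhood is respected from its own number on.\<close>
  define Q where "Q k j x \<longleftrightarrow> (\<forall>i\<in>{..k}. liminf (\<lambda>k. f k x) \<in> b i \<longrightarrow> f j x \<in> b i)" for k j :: nat and x
  have [measurable]: "Measurable.pred G (Q k j)" for k j
    unfolding Q_def by measurable
  have fr: "\<exists>j\<ge>m. Q k j x" if "x \<in> space G" for k m x
  proof -
    let ?L = "liminf (\<lambda>k. f k x)"
    have "open (\<Inter>i\<in>{i\<in>{..k}. ?L \<in> b i}. b i)" using op by (intro open_INT) auto
    then have "\<exists>j\<ge>m. f j x \<in> (\<Inter>i\<in>{i\<in>{..k}. ?L \<in> b i}. b i)"
      by (rule frequently_near_liminf) auto
    then show ?thesis by (auto simp: Q_def)
  qed
  obtain \<tau> where t: "\<And>k. \<tau> k \<in> measurable G (count_space UNIV)"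
    "\<And>x. x \<in> space G \<Longrightarrow> strict_mono (\<lambda>k. \<tau> k x)"
    "\<And>k x. x \<in> space G \<Longrightarrow> Q k (\<tau> k x) x"
    using measurable_random_indices[of Q G] fr by auto
  have "(\<lambda>k. f (\<tau> k x) x) \<longlonglongrightarrow> liminf (\<lambda>k. f k x)" if x: "x \<in> space G" for x
  proof (rule topological_tendstoI)
    fix S assume "open S" "liminf (\<lambda>k. f k x) \<in> S"
    then obtain i where i: "liminf (\<lambda>k. f k x) \<in> b i" "b i \<subseteq> S"
      using topological_basisE[OF B(2), of S] b by (metis imageE)
    have "\<forall>\<^sub>F k in sequentially. k \<ge> i" by simp
    then show "\<forall>\<^sub>F k in sequentially. f (\<tau> k x) x \<in> S"
      by eventually_elim (use t(3)[OF x] i in \<open>auto simp: Q_def\<close>)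
  qed
  with t that show thesis by blast
qed

section \<open>Backward induction over the coordinates\<close>

text \<open>
  \<open>f\<close> is the integrand made nonnegative by subtracting \<open>m\<close>, and \<open>H\<close> the positive part of its
  horizon function. The coordinates are handled one at a time, in the order \<open>r\<close> refining the
  stages; \<open>G i\<close> is the information available for the coordinate of rank \<open>i\<close>, and \<open>G d = M\<close>.
\<close>

locale recession_program = prob_space M
  for M :: "'a measure" +
  fixes G :: "nat \<Rightarrow> 'a measure" and r :: "'n::finite \<Rightarrow> nat" and d :: nat
    and f H :: "real ^ 'n \<Rightarrow> 'a \<Rightarrow> ennreal"
    and N :: "'a \<Rightarrow> (real ^ 'n) set"
  assumes subalg: "subalgebra M (G i)"
    and sets_G_mono: "i \<le> j \<Longrightarrow> sets (G i) \<subseteq> sets (G j)"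
    and G_d: "G d = M"
    and inj_r: "inj r" and range_r: "range r = {..<d}"
    and f_measurable: "x \<in> borel_measurable M \<Longrightarrow> (\<lambda>\<omega>. f (x \<omega>) \<omega>) \<in> borel_measurable M"
    and f_lsc: "\<omega> \<in> space M \<Longrightarrow> z \<longlonglongrightarrow> y \<Longrightarrow> f y \<omega> \<le> liminf (\<lambda>k. f (z k) \<omega>)"
    and H_lsc: "\<omega> \<in> space M \<Longrightarrow> (\<And>k::nat. l k > 0) \<Longrightarrow> l \<longlonglongrightarrow> 0 \<Longrightarrow> (\<lambda>k. l k *\<^sub>R z k) \<longlonglongrightarrow> y \<Longrightarrow>
      H y \<omega> \<le> liminf (\<lambda>k. ennreal (l k) * f (z k) \<omega>)"
    and H_zero: "AE \<omega> in M. H 0 \<omega> = 0"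
    and subspace_N: "\<omega> \<in> space M \<Longrightarrow> subspace (N \<omega>)"
    and recession_N: "w \<in> adapted_strategies G r \<Longrightarrow> AE \<omega> in M. H (w \<omega>) \<omega> = 0 \<Longrightarrow>
      AE \<omega> in M. w \<omega> \<in> N \<omega>"
    and integral_invariant: "x \<in> adapted_strategies G r \<Longrightarrow> w \<in> adapted_strategies G r \<Longrightarrow>
      AE \<omega> in M. w \<omega> \<in> N \<omega> \<Longrightarrow> (\<integral>\<^sup>+\<omega>. f (x \<omega>) \<omega> \<partial>M) < \<infinity> \<Longrightarrow>
      (\<integral>\<^sup>+\<omega>. f (x \<omega> + w \<omega>) \<omega> \<partial>M) = (\<integral>\<^sup>+\<omega>. f (x \<omega>) \<omega> \<partial>M)"
begin

lemma space_G: "space (G i) = space M"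
  using subalg by (simp add: subalgebra_def)

lemma sets_G: "A \<in> sets (G i) \<Longrightarrow> A \<in> sets M"
  using subalg by (auto simp: subalgebra_def)

lemma subalgebra_G: "i \<le> j \<Longrightarrow> subalgebra (G j) (G i)"
  using sets_G_mono by (simp add: subalgebra_def space_G)

lemma measurable_G_mono: "i \<le> j \<Longrightarrow> g \<in> measurable (G i) L \<Longrightarrow> g \<in> measurable (G j) L"
  using measurable_from_subalg[OF subalgebra_G] .

lemma measurable_G: "g \<in> measurable (G i) L \<Longrightarrow> g \<in> measurable M L"
  using measurable_from_subalg[OF subalg] .

lemma sigma_finite_subalgebra_G: "sigma_finite_subalgebra M (G i)"
  by (intro finite_measure_subalgebra_is_sigma_finite finite_measure_subalgebra.intro
      finite_measure_subalgebra_axioms.intro subalg) unfold_locales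

section \<open>Pasted strategies and invariance of conditional costs\<close>

abbreviation cexp :: "nat \<Rightarrow> ('a \<Rightarrow> real ^ 'n) \<Rightarrow> 'a \<Rightarrow> ennreal" where
  "cexp i x \<equiv> nn_cond_exp M (G i) (\<lambda>\<omega>. f (x \<omega>) \<omega>)"

text \<open>Finite expectation allows the integral over the complement of an event to be cancelled
  when the invariance is localised.\<close>

definition finite_strategies :: "('a \<Rightarrow> real ^ 'n) set" where
  "finite_strategies = {x \<in> adapted_strategies G r. (\<integral>\<^sup>+\<omega>. f (x \<omega>) \<omega> \<partial>M) < \<infinity>}"

text \<open>
  A random subsequence of adapted strategies is in general not adapted before the time at which
  its indices are known, so the compactness argument has to leave \<open>adapted_strategies\<close>; the
  invariance of the expectation along \<open>N\<close> survives because it holds on each piece.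
\<close>

definition pasted :: "nat \<Rightarrow> ('a \<Rightarrow> real ^ 'n) set" where
  "pasted i = {\<lambda>\<omega>. x (J \<omega>) \<omega> | x J. range x \<subseteq> finite_strategies \<and> J \<in> measurable (G i) (count_space (UNIV :: nat set))}"

text \<open>Vanishing before rank \<open>i\<close> makes the class stable under
  \<open>G i\<close>-measurable scalars: coordinates of rank at least \<open>i\<close> may depend on
  \<open>G i\<close>, and the earlier ones stay zero.\<close>

definition directions :: "nat \<Rightarrow> ('a \<Rightarrow> real ^ 'n) set" where
  "directions i = {w \<in> adapted_strategies G r. (AE \<omega> in M. w \<omega> \<in> N \<omega>) \<and> (\<forall>\<omega> c. r c < i \<longrightarrow> w \<omega> $ c = 0)}"

lemma adapted_component:
  "x \<in> adapted_strategies G r \<Longrightarrow> r c \<le> i \<Longrightarrow> (\<lambda>\<omega>. x \<omega> $ c) \<in> borel_measurable (G i)"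
  unfolding adapted_strategies_def using measurable_G_mono by blast

lemma adapted_measurable: "x \<in> adapted_strategies G r \<Longrightarrow> x \<in> borel_measurable M"
  by (rule borel_measurable_vec_components) (auto simp: adapted_strategies_def intro: measurable_G)

lemma pasted_component:
  assumes "z \<in> pasted i" "r c \<le> i"
  shows "(\<lambda>\<omega>. z \<omega> $ c) \<in> borel_measurable (G i)"
proof -
  obtain x J where z: "z = (\<lambda>\<omega>. x (J \<omega>) \<omega>)" and x: "range x \<subseteq> finite_strategies"
    and J: "J \<in> measurable (G i) (count_space (UNIV :: nat set))"
    using assms by (auto simp: pasted_def)
  show ?thesis unfolding z
    by (rule measurable_compose_countable[OF _ J])
      (use x assms in \<open>auto simp: finite_strategies_def intro!: adapted_component\<close>)
qed

lemma pasted_measurable: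
  assumes "z \<in> pasted i"
  shows "z \<in> borel_measurable M"
proof -
  obtain x J where z: "z = (\<lambda>\<omega>. x (J \<omega>) \<omega>)" and x: "range x \<subseteq> finite_strategies"
    and J: "J \<in> measurable (G i) (count_space (UNIV :: nat set))"
    using assms by (auto simp: pasted_def)
  show ?thesis unfolding z
    by (rule measurable_compose_countable[OF _ measurable_G[OF J]])
      (use x assms in \<open>auto simp: finite_strategies_def intro!: adapted_measurable\<close>)
qed

lemma pasted_mono:
  assumes "i \<le> j" shows "pasted i \<subseteq> pasted j"
  using measurable_G_mono[OF assms] unfolding pasted_def by blast

lemma finite_strategies_pasted: "x \<in> finite_strategies \<Longrightarrow> x \<in> pasted i"
  unfolding pasted_def by (auto intro!: exI[of _ "\<lambda>_. x"] exI[of _ "\<lambda>_. 0"])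

lemma pasted_select:
  assumes z: "\<And>k. z k \<in> pasted i" and \<tau>: "\<tau> \<in> measurable (G i) (count_space (UNIV :: nat set))"
  shows "(\<lambda>\<omega>. z (\<tau> \<omega>) \<omega>) \<in> pasted i"
proof -
  have "\<forall>k. \<exists>x J. z k = (\<lambda>\<omega>. x (J \<omega>) \<omega>) \<and> range x \<subseteq> finite_strategies \<and>
      J \<in> measurable (G i) (count_space (UNIV :: nat set))"
    using z by (auto simp: pasted_def)
  then obtain x J where zk: "\<And>k. z k = (\<lambda>\<omega>. x k (J k \<omega>) \<omega>)" and x: "\<And>k. range (x k) \<subseteq> finite_strategies"
    and J[measurable]: "\<And>k. J k \<in> measurable (G i) (count_space (UNIV :: nat set))"
    unfolding choice_iff by blast
  \<comment> \<open>A selection among pasted strategies uses an outer and an inner index; coding the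
    pair as one natural number turns it into a single selection.\<close>
  have "(\<lambda>\<omega>. (\<lambda>m. x (fst (prod_decode m)) (snd (prod_decode m))) (prod_encode (\<tau> \<omega>, J (\<tau> \<omega>) \<omega>)) \<omega>) \<in> pasted i"
    unfolding pasted_def
  proof (intro CollectI exI conjI)
    show "(\<lambda>\<omega>. prod_encode (\<tau> \<omega>, J (\<tau> \<omega>) \<omega>)) \<in> measurable (G i) (count_space UNIV)"
      by (rule measurable_compose_countable[OF _ \<tau>], rule measurable_compose[OF J]) simp
    show "range (\<lambda>m. x (fst (prod_decode m)) (snd (prod_decode m))) \<subseteq> finite_strategies"
      using x by auto
  qed (rule refl)
  then show ?thesis by (simp add: zk)
qed

lemma adapted_scale:
  assumes w: "w \<in> adapted_strategies G r" "\<And>\<omega> c. r c < i \<Longrightarrow> w \<omega> $ c = 0"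
    and u: "u \<in> borel_measurable (G i)"
  shows "(\<lambda>\<omega>. u \<omega> *\<^sub>R w \<omega>) \<in> adapted_strategies G r"
  unfolding adapted_strategies_def
proof (intro CollectI allI)
  fix c
  show "(\<lambda>\<omega>. (u \<omega> *\<^sub>R w \<omega>) $ c) \<in> borel_measurable (G (r c))"
  proof (cases "r c < i")
    case True
    then show ?thesis using w by simp
  next
    case False
    then have [measurable]: "u \<in> borel_measurable (G (r c))" using measurable_G_mono[OF _ u] by simp
    have [measurable]: "(\<lambda>\<omega>. w \<omega> $ c) \<in> borel_measurable (G (r c))"
      using w by (auto simp: adapted_strategies_def)
    show ?thesis by simp
  qed
qed

lemma directions_scale:
  assumes w: "w \<in> directions i" and u: "u \<in> borel_measurable (G i)"
  shows "(\<lambda>\<omega>. u \<omega> *\<^sub>R w \<omega>) \<in> directions i"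
  unfolding directions_def
proof (intro CollectI conjI)
  show "(\<lambda>\<omega>. u \<omega> *\<^sub>R w \<omega>) \<in> adapted_strategies G r"
    using w by (intro adapted_scale[OF _ _ u]) (auto simp: directions_def)
  show "AE \<omega> in M. u \<omega> *\<^sub>R w \<omega> \<in> N \<omega>"
    using w AE_space unfolding directions_def
    by (auto elim!: eventually_elim2 intro: subspace_scale subspace_N)
qed (use w in \<open>auto simp: directions_def\<close>)

lemma finite_strategies_add:
  assumes x: "x \<in> finite_strategies" and w: "w \<in> directions i"
  shows "(\<lambda>\<omega>. x \<omega> + w \<omega>) \<in> finite_strategies"
    and "(\<integral>\<^sup>+\<omega>. f (x \<omega> + w \<omega>) \<omega> \<partial>M) = (\<integral>\<^sup>+\<omega>. f (x \<omega>) \<omega> \<partial>M)"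
proof -
  show *: "(\<integral>\<^sup>+\<omega>. f (x \<omega> + w \<omega>) \<omega> \<partial>M) = (\<integral>\<^sup>+\<omega>. f (x \<omega>) \<omega> \<partial>M)"
    using x w by (intro integral_invariant) (auto simp: finite_strategies_def directions_def)
  show "(\<lambda>\<omega>. x \<omega> + w \<omega>) \<in> finite_strategies"
    using x w * by (auto simp: finite_strategies_def adapted_strategies_def directions_def intro!: borel_measurable_add)
qed

text \<open>Invariance of the full expectation localises: for \<open>A\<close> in \<open>G i\<close>
  the direction may be replaced by its restriction to \<open>A\<close>, which is again admissible.
  The cost off \<open>A\<close> is then unchanged and finite, so it cancels and equality remains
  over \<open>A\<close>.\<close>

lemma cexp_finite_strategies_add:
  assumes x: "x \<in> finite_strategies" and w: "w \<in> directions i"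
  shows "AE \<omega> in M. cexp i (\<lambda>\<omega>. x \<omega> + w \<omega>) \<omega> = cexp i x \<omega>"
proof -
  interpret C: sigma_finite_subalgebra M "G i" by (rule sigma_finite_subalgebra_G)
  have [measurable]: "x \<in> borel_measurable M" "w \<in> borel_measurable M"
    using x w by (auto simp: finite_strategies_def directions_def intro!: adapted_measurable)
  have [measurable]: "(\<lambda>\<omega>. f (x \<omega>) \<omega>) \<in> borel_measurable M" "(\<lambda>\<omega>. f (x \<omega> + w \<omega>) \<omega>) \<in> borel_measurable M"
    by (auto intro: f_measurable)
  have "AE \<omega> in M. cexp i x \<omega> = cexp i (\<lambda>\<omega>. x \<omega> + w \<omega>) \<omega>"
  proof (rule C.nn_cond_exp_charact)
    fix A assume A: "A \<in> sets (G i)"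
    then have [measurable]: "A \<in> sets M" by (rule sets_G)
    define v where "v \<omega> = indicator A \<omega> *\<^sub>R w \<omega>" for \<omega>
    have v: "v \<in> directions i" unfolding v_def by (rule directions_scale[OF w]) (use A in auto)
    have split: "(\<integral>\<^sup>+\<omega>. g \<omega> \<partial>M) = (\<integral>\<^sup>+\<omega>\<in>A. g \<omega> \<partial>M) + (\<integral>\<^sup>+\<omega>\<in>- A. g \<omega> \<partial>M)"
      if [measurable]: "g \<in> borel_measurable M" for g
    proof -
      have [measurable]: "(\<lambda>\<omega>. indicator (- A) \<omega> :: ennreal) \<in> borel_measurable M"
        by (subst measurable_cong[where g="indicator (space M - A)"]) (auto simp: indicator_def)
      show ?thesis
        by (subst nn_integral_add[symmetric]) (auto intro!: nn_integral_cong simp: indicator_def)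
    qed
    have [measurable]: "v \<in> borel_measurable M"
      using v by (auto simp: directions_def intro!: adapted_measurable)
    have fv: "(\<lambda>\<omega>. f (x \<omega> + v \<omega>) \<omega>) \<in> borel_measurable M" by (auto intro: f_measurable)
    have "(\<integral>\<^sup>+\<omega>\<in>A. f (x \<omega> + v \<omega>) \<omega> \<partial>M) + (\<integral>\<^sup>+\<omega>\<in>- A. f (x \<omega> + v \<omega>) \<omega> \<partial>M) =
        (\<integral>\<^sup>+\<omega>\<in>A. f (x \<omega>) \<omega> \<partial>M) + (\<integral>\<^sup>+\<omega>\<in>- A. f (x \<omega>) \<omega> \<partial>M)"
      using finite_strategies_add(2)[OF x v] split[of "\<lambda>\<omega>. f (x \<omega>) \<omega>"] split[OF fv] by simp
    moreover have "(\<integral>\<^sup>+\<omega>\<in>A. f (x \<omega> + v \<omega>) \<omega> \<partial>M) = (\<integral>\<^sup>+\<omega>\<in>A. f (x \<omega> + w \<omega>) \<omega> \<partial>M)"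
      by (intro nn_integral_cong) (auto simp: v_def indicator_def)
    moreover have "(\<integral>\<^sup>+\<omega>\<in>- A. f (x \<omega> + v \<omega>) \<omega> \<partial>M) = (\<integral>\<^sup>+\<omega>\<in>- A. f (x \<omega>) \<omega> \<partial>M)"
      by (intro nn_integral_cong) (auto simp: v_def indicator_def)
    moreover have "(\<integral>\<^sup>+\<omega>\<in>- A. f (x \<omega>) \<omega> \<partial>M) \<noteq> \<infinity>"
      using x split[of "\<lambda>\<omega>. f (x \<omega>) \<omega>"] by (auto simp: finite_strategies_def)
    ultimately have "(\<integral>\<^sup>+\<omega>\<in>A. f (x \<omega> + w \<omega>) \<omega> \<partial>M) = (\<integral>\<^sup>+\<omega>\<in>A. f (x \<omega>) \<omega> \<partial>M)"
      by (simp add: ennreal_add_left_cancel add.commute)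
    then show "(\<integral>\<^sup>+\<omega>\<in>A. f (x \<omega> + w \<omega>) \<omega> \<partial>M) = (\<integral>\<^sup>+\<omega>\<in>A. cexp i x \<omega> \<partial>M)"
      using A by (simp add: C.nn_cond_exp_set_integral)
  qed auto
  then show ?thesis by (auto simp: eq_commute)
qed

text \<open>Invariance is known only for adapted strategies, so it is applied to each piece
  \<open>x j\<close> with the same \<open>w\<close> and reassembled along the
  \<open>G i\<close>-measurable index.\<close>

lemma pasted_add:
  assumes z: "z \<in> pasted i" and w: "w \<in> directions i"
  shows "(\<lambda>\<omega>. z \<omega> + w \<omega>) \<in> pasted i"
    and "AE \<omega> in M. cexp i (\<lambda>\<omega>. z \<omega> + w \<omega>) \<omega> = cexp i z \<omega>"
proof -
  interpret C: sigma_finite_subalgebra M "G i" by (rule sigma_finite_subalgebra_G)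
  obtain x J where z: "z = (\<lambda>\<omega>. x (J \<omega>) \<omega>)" and x: "range x \<subseteq> finite_strategies"
    and J: "J \<in> measurable (G i) (count_space (UNIV :: nat set))"
    using z by (auto simp: pasted_def)
  show "(\<lambda>\<omega>. z \<omega> + w \<omega>) \<in> pasted i"
    unfolding pasted_def z
    by (intro CollectI exI[of _ "\<lambda>j \<omega>. x j \<omega> + w \<omega>"] exI[of _ J])
      (use x w J finite_strategies_add in auto)
  have [measurable]: "x j \<in> borel_measurable M" "w \<in> borel_measurable M" for j
    using x w by (auto simp: finite_strategies_def directions_def intro!: adapted_measurable)
  have "AE \<omega> in M. nn_cond_exp M (G i) (\<lambda>\<omega>. f (x (J \<omega>) \<omega>) \<omega>) \<omega> = cexp i (x (J \<omega>)) \<omega>"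
    by (rule C.nn_cond_exp_piecewise[OF J, of "\<lambda>j \<omega>. f (x j \<omega>) \<omega>"]) (simp add: f_measurable)
  moreover have "AE \<omega> in M. nn_cond_exp M (G i) (\<lambda>\<omega>. f (x (J \<omega>) \<omega> + w \<omega>) \<omega>) \<omega> =
      cexp i (\<lambda>\<omega>'. x (J \<omega>) \<omega>' + w \<omega>') \<omega>"
    by (rule C.nn_cond_exp_piecewise[OF J, of "\<lambda>j \<omega>. f (x j \<omega> + w \<omega>) \<omega>"]) (simp add: f_measurable)
  moreover have "AE \<omega> in M. \<forall>j. cexp i (\<lambda>\<omega>. x j \<omega> + w \<omega>) \<omega> = cexp i (x j) \<omega>"
    unfolding AE_all_countable using x w by (auto intro: cexp_finite_strategies_add)
  ultimately show "AE \<omega> in M. cexp i (\<lambda>\<omega>. z \<omega> + w \<omega>) \<omega> = cexp i z \<omega>"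
    unfolding z by eventually_elim simp
qed

lemma cexp_select:
  assumes z: "\<And>k. z k \<in> pasted i" and \<tau>: "\<tau> \<in> measurable (G i) (count_space (UNIV :: nat set))"
  shows "AE \<omega> in M. cexp i (\<lambda>\<omega>. z (\<tau> \<omega>) \<omega>) \<omega> = cexp i (z (\<tau> \<omega>)) \<omega>"
  using sigma_finite_subalgebra.nn_cond_exp_piecewise[OF sigma_finite_subalgebra_G \<tau>, of "\<lambda>k \<omega>. f (z k \<omega>) \<omega>"]
    pasted_measurable[OF z] f_measurable by simp

section \<open>Largest event on which a coordinate can be cancelled\<close>

text \<open>The entry \<open>1\<close> is a normalisation: subtracting \<open>z $ c\<close> times
  such a \<open>w\<close> cancels coordinate \<open>c\<close> of \<open>z\<close> and leaves the
  coordinates of smaller rank alone.\<close>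

definition direction_sets :: "'n \<Rightarrow> 'a set set" where
  "direction_sets c = {C \<in> sets (G (r c)). \<exists>w\<in>directions (r c). \<forall>\<omega>\<in>C. w \<omega> $ c = 1}"

lemma zero_directions: "(\<lambda>_. 0) \<in> directions i"
  using AE_space by (auto simp: directions_def adapted_strategies_def intro: subspace_0 subspace_N)

lemma direction_sets_UN:
  fixes C :: "nat \<Rightarrow> 'a set"
  assumes C: "\<And>k. C k \<in> direction_sets c"
  shows "(\<Union>k. C k) \<in> direction_sets c"
proof -
  have C': "C k \<in> sets (G (r c))" for k using C by (auto simp: direction_sets_def)
  have "\<exists>w\<in>directions (r c). \<forall>\<omega>\<in>C k. w \<omega> $ c = 1" for k
    using C[of k] by (auto simp: direction_sets_def)
  then obtain w where w: "\<And>k. w k \<in> directions (r c)" "\<And>k \<omega>. \<omega> \<in> C k \<Longrightarrow> w k \<omega> $ c = 1"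
    by metis
  \<comment> \<open>The directions are pasted by the first set containing \<omega>. This index is
    known from rank \<open>r c\<close> on, which suffices because all of them vanish at smaller
    ranks.\<close>
  define J where "J \<omega> = (LEAST k. \<omega> \<in> C k)" for \<omega>
  define W where "W \<omega> = (if \<omega> \<in> (\<Union>k. C k) then w (J \<omega>) \<omega> else 0)" for \<omega>
  have J: "J \<in> measurable (G i) (count_space UNIV)" if "r c \<le> i" for i
  proof -
    have [measurable]: "C k \<in> sets (G i)" for k using C' sets_G_mono[OF that] by auto
    show ?thesis unfolding J_def by measurable
  qed
  have "W \<in> directions (r c)"
    unfolding directions_def
  proof (intro CollectI conjI)
    show "W \<in> adapted_strategies G r"
      unfolding adapted_strategies_def
    proof (intro CollectI allI)
      fix b
      show "(\<lambda>\<omega>. W \<omega> $ b) \<in> borel_measurable (G (r b))"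
      proof (cases "r b < r c")
        case True
        then show ?thesis using w by (simp add: directions_def W_def if_distrib[of "\<lambda>x. x $ b"] cong: if_cong)
      next
        case False
        have [measurable]: "C k \<in> sets (G (r b))" for k using C' sets_G_mono False by (meson not_less subsetD)
        have [measurable]: "(\<lambda>\<omega>. w (J \<omega>) \<omega> $ b) \<in> borel_measurable (G (r b))"
        proof (rule measurable_compose_countable[OF _ J])
          show "(\<lambda>\<omega>. w k \<omega> $ b) \<in> borel_measurable (G (r b))" for k
            using w(1)[of k] by (simp add: directions_def adapted_strategies_def)
        qed (use False in simp)
        show ?thesis unfolding W_def if_distrib[of "\<lambda>x. x $ b"] by measurable
      qed
    qed
    have "AE \<omega> in M. \<forall>k. w k \<omega> \<in> N \<omega>"
      unfolding AE_all_countable using w by (auto simp: directions_def)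
    with AE_space show "AE \<omega> in M. W \<omega> \<in> N \<omega>"
      by eventually_elim (auto simp: W_def intro: subspace_0 subspace_N)
  qed (use w in \<open>auto simp: directions_def W_def\<close>)
  moreover have "\<forall>\<omega>\<in>(\<Union>k. C k). W \<omega> $ c = 1"
  proof
    fix \<omega> assume *: "\<omega> \<in> (\<Union>k. C k)"
    then have "\<omega> \<in> C (J \<omega>)" unfolding J_def by (auto intro: LeastI)
    with w * show "W \<omega> $ c = 1" by (simp add: W_def)
  qed
  ultimately show ?thesis using C' by (auto simp: direction_sets_def)
qed

text \<open>Exhaustion: countably many direction sets whose measures approach the supremum have a
  union that attains it, and adjoining a disjoint direction set of positive measure would exceed
  it.\<close>

lemma ex_maximal_direction_set:
  obtains C w where "C \<in> sets (G (r c))" "w \<in> directions (r c)" "\<And>\<omega>. \<omega> \<in> C \<Longrightarrow> w \<omega> $ c = 1"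
    "\<And>C'. C' \<in> direction_sets c \<Longrightarrow> C' \<inter> C = {} \<Longrightarrow> C' \<in> null_sets M"
proof -
  have "{} \<in> direction_sets c" using zero_directions by (auto simp: direction_sets_def)
  then obtain g where g: "range g \<subseteq> emeasure M ` direction_sets c"
    "Sup (emeasure M ` direction_sets c) = Sup (range (g :: nat \<Rightarrow> ennreal))"
    using ennreal_SUP_countable_SUP[of "direction_sets c" "emeasure M"] by auto
  then have "\<exists>C. C \<in> direction_sets c \<and> g k = emeasure M C" for k by auto
  then obtain C where C: "\<And>k. C k \<in> direction_sets c" "\<And>k. g k = emeasure M (C k)" by metis
  define U where "U = (\<Union>k. C k)"
  have sM: "C \<in> sets M" if "C \<in> direction_sets c" for C using that sets_G by (auto simp: direction_sets_def)
  have U: "U \<in> direction_sets c" unfolding U_def by (rule direction_sets_UN[OF C(1)])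
  have max: "emeasure M C' \<le> emeasure M U" if "C' \<in> direction_sets c" for C'
  proof -
    have "emeasure M C' \<le> Sup (range g)" unfolding g(2)[symmetric] using that by (rule SUP_upper)
    also have "\<dots> \<le> emeasure M U"
      using sM[OF U] C by (auto intro!: SUP_least emeasure_mono simp: U_def)
    finally show ?thesis .
  qed
  have null: "C' \<in> null_sets M" if C': "C' \<in> direction_sets c" "C' \<inter> U = {}" for C'
  proof -
    have "(\<Union>k::nat. if k = 0 then C' else U) \<in> direction_sets c"
      using C' U by (intro direction_sets_UN) auto
    moreover have "(\<Union>k::nat. if k = 0 then C' else U) = C' \<union> U"
    proof
      show "C' \<union> U \<subseteq> (\<Union>k::nat. if k = 0 then C' else U)"
        using UN_upper[of 0 UNIV "\<lambda>k::nat. if k = 0 then C' else U"]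
          UN_upper[of 1 UNIV "\<lambda>k::nat. if k = 0 then C' else U"] by simp
    qed (intro UN_least, simp)
    ultimately have "emeasure M (C' \<union> U) \<le> emeasure M U" using max by metis
    then have "emeasure M C' + emeasure M U \<le> emeasure M U"
      using C' sM U by (subst plus_emeasure) auto
    then have "emeasure M C' = 0"
      using emeasure_finite[of U] ennreal_add_left_cancel_le[of "emeasure M U" "emeasure M C'" 0]
      by (auto simp: add.commute)
    with sM[OF C'(1)] show ?thesis by auto
  qed
  obtain w where "w \<in> directions (r c)" "\<And>\<omega>. \<omega> \<in> U \<Longrightarrow> w \<omega> $ c = 1"
    using U by (auto simp: direction_sets_def)
  with U null that show thesis by (auto simp: direction_sets_def)
qed

section \<open>Backward induction\<close>

text \<open>
  The invariant of the backward induction. For \<open>rec = False\<close> it says that a pasted sequence whose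
  coordinates of rank \<open>< i\<close> converge can be replaced by an adapted strategy with these limits
  without increasing the conditional cost. The scaled variant \<open>rec = True\<close> has to be carried
  along, since it produces the recession directions that exclude unbounded sequences. The
  function \<open>\<phi>\<close> stands in for the cost of \<open>y\<close>, so that \<open>H (y \<omega>) \<omega>\<close> need not be measurable.
\<close>

definition closable :: "nat \<Rightarrow> bool" where
  "closable i \<longleftrightarrow> (\<forall>rec D z l x.
    D \<in> sets (G i) \<longrightarrow> (\<forall>k. z k \<in> pasted i) \<longrightarrow> (\<forall>k. l k \<in> borel_measurable (G i)) \<longrightarrow>
    (\<forall>k \<omega>. 0 < l k \<omega>) \<longrightarrow>
    (\<forall>\<omega>\<in>D. if rec then (\<lambda>k::nat. l k \<omega>) \<longlonglongrightarrow> 0 else (\<forall>k. l k \<omega> = 1)) \<longrightarrow>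
    x \<in> adapted_strategies G r \<longrightarrow>
    (\<forall>\<omega>\<in>D. \<forall>c. r c < i \<longrightarrow> (\<lambda>k. l k \<omega> * z k \<omega> $ c) \<longlonglongrightarrow> x \<omega> $ c) \<longrightarrow>
    (\<exists>y\<in>adapted_strategies G r. \<exists>\<phi>\<in>borel_measurable M.
      (\<forall>\<omega> c. r c < i \<longrightarrow> y \<omega> $ c = x \<omega> $ c) \<and>
      (\<forall>\<omega>\<in>D. (if rec then H else f) (y \<omega>) \<omega> \<le> \<phi> \<omega>) \<and>
      (AE \<omega> in M. \<omega> \<in> D \<longrightarrow>
        nn_cond_exp M (G i) \<phi> \<omega> \<le> liminf (\<lambda>k. ennreal (l k \<omega>) * cexp i (z k) \<omega>))))"

lemma closableE:
  fixes rec :: bool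
  assumes "closable i"
    and "D \<in> sets (G i)" "\<And>k. z k \<in> pasted i" "\<And>k. l k \<in> borel_measurable (G i)"
    and "\<And>k \<omega>. 0 < l k \<omega>"
    and "\<And>\<omega>. \<omega> \<in> D \<Longrightarrow> if rec then (\<lambda>k::nat. l k \<omega>) \<longlonglongrightarrow> 0 else (\<forall>k. l k \<omega> = 1)"
    and "x \<in> adapted_strategies G r"
    and "\<And>\<omega> c. \<omega> \<in> D \<Longrightarrow> r c < i \<Longrightarrow> (\<lambda>k. l k \<omega> * z k \<omega> $ c) \<longlonglongrightarrow> x \<omega> $ c"
  obtains y \<phi> where "y \<in> adapted_strategies G r" "\<phi> \<in> borel_measurable M"
    "\<And>\<omega> c. r c < i \<Longrightarrow> y \<omega> $ c = x \<omega> $ c"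
    "\<And>\<omega>. \<omega> \<in> D \<Longrightarrow> (if rec then H else f) (y \<omega>) \<omega> \<le> \<phi> \<omega>"
    "AE \<omega> in M. \<omega> \<in> D \<longrightarrow>
        nn_cond_exp M (G i) \<phi> \<omega> \<le> liminf (\<lambda>k. ennreal (l k \<omega>) * cexp i (z k) \<omega>)"
  using assms(1)[unfolded closable_def, rule_format, of D z l rec x] assms(2-) by blast

text \<open>At rank \<open>d\<close> everything is observed, so conditional costs are pathwise
  costs, and every coordinate is prescribed. Take \<open>y = x\<close> and let \<phi> be the
  pathwise lower limit; semicontinuity of \<open>f\<close>, or the recession inequality for
  \<open>H\<close>, gives the bound.\<close>

lemma closable_d: "closable d"
  unfolding closable_def
proof (intro allI impI)
  fix rec D z l x
  assume D: "D \<in> sets (G d)" and z: "\<forall>k. z k \<in> pasted d"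
    and l: "\<forall>k::nat. l k \<in> borel_measurable (G d)" and pos: "\<forall>k \<omega>. 0 < (l k \<omega> :: real)"
    and lim: "\<forall>\<omega>\<in>D. if rec then (\<lambda>k. l k \<omega>) \<longlonglongrightarrow> 0 else (\<forall>k. l k \<omega> = 1)"
    and x: "x \<in> adapted_strategies G r"
    and conv: "\<forall>\<omega>\<in>D. \<forall>c. r c < d \<longrightarrow> (\<lambda>k. l k \<omega> * z k \<omega> $ c) \<longlonglongrightarrow> x \<omega> $ c"
  have r_less: "r c < d" for c using range_r by auto
  interpret C: sigma_finite_subalgebra M M using sigma_finite_subalgebra_G[of d] by (simp add: G_d)
  have [measurable]: "l k \<in> borel_measurable M" for k using l by (simp add: G_d)
  have fz[measurable]: "(\<lambda>\<omega>. f (z k \<omega>) \<omega>) \<in> borel_measurable M" for k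
    using z pasted_measurable f_measurable by blast
  define \<phi> where "\<phi> \<omega> = liminf (\<lambda>k. ennreal (l k \<omega>) * f (z k \<omega>) \<omega>)" for \<omega>
  have [measurable]: "\<phi> \<in> borel_measurable M" unfolding \<phi>_def by measurable
  show "\<exists>y\<in>adapted_strategies G r. \<exists>\<phi>\<in>borel_measurable M.
      (\<forall>\<omega> c. r c < d \<longrightarrow> y \<omega> $ c = x \<omega> $ c) \<and>
      (\<forall>\<omega>\<in>D. (if rec then H else f) (y \<omega>) \<omega> \<le> \<phi> \<omega>) \<and>
      (AE \<omega> in M. \<omega> \<in> D \<longrightarrow>
        nn_cond_exp M (G d) \<phi> \<omega> \<le> liminf (\<lambda>k. ennreal (l k \<omega>) * cexp d (z k) \<omega>))"
  proof (intro bexI[of _ x] bexI[of _ \<phi>] conjI allI impI ballI)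
    fix \<omega> assume \<omega>: "\<omega> \<in> D"
    then have sp: "\<omega> \<in> space M" using D sets.sets_into_space by (auto simp: G_d)
    have "(\<lambda>k. l k \<omega> *\<^sub>R z k \<omega>) \<longlonglongrightarrow> x \<omega>"
      using conv \<omega> r_less by (intro vec_tendstoI) auto
    then show "(if rec then H else f) (x \<omega>) \<omega> \<le> \<phi> \<omega>"
      using lim \<omega> H_lsc[OF sp, of "\<lambda>k. l k \<omega>"] f_lsc[OF sp] pos
      by (auto simp: \<phi>_def split: if_splits)
  next
    have "AE \<omega> in M. \<phi> \<omega> = nn_cond_exp M M \<phi> \<omega>" by (rule C.nn_cond_exp_F_meas) simp
    moreover have "AE \<omega> in M. \<forall>k. f (z k \<omega>) \<omega> = nn_cond_exp M M (\<lambda>\<omega>. f (z k \<omega>) \<omega>) \<omega>"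
      unfolding AE_all_countable by (intro allI C.nn_cond_exp_F_meas) simp
    ultimately show "AE \<omega> in M. \<omega> \<in> D \<longrightarrow>
        nn_cond_exp M (G d) \<phi> \<omega> \<le> liminf (\<lambda>k. ennreal (l k \<omega>) * cexp d (z k) \<omega>)"
      unfolding G_d by eventually_elim (simp add: \<phi>_def)
  qed (use x in auto)
qed

text \<open>
  Dividing by \<open>max 1 \<bar>l z\<^sub>c\<bar>\<close> sends the conditional costs to \<open>0\<close>, while coordinate \<open>c\<close> tends to
  \<open>1\<close> or \<open>-1\<close>: the limit is a recession direction.
\<close>

lemma unbounded_direction_set:
  assumes cl: "closable (Suc (r c))" and U: "U \<in> sets (G (r c))"
    and z: "\<And>k. z k \<in> pasted (r c)" and l: "\<And>k. l k \<in> borel_measurable (G (r c))"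
    and pos: "\<And>k \<omega>. 0 < l k \<omega>"
    and conv_l: "\<And>\<omega>. \<omega> \<in> U \<Longrightarrow> convergent (\<lambda>k::nat. l k \<omega>)"
    and conv: "\<And>\<omega> b. \<omega> \<in> U \<Longrightarrow> r b < r c \<Longrightarrow> convergent (\<lambda>k. l k \<omega> * z k \<omega> $ b)"
    and q: "q \<in> borel_measurable (G (r c))" "\<And>\<omega>. \<omega> \<in> U \<Longrightarrow> \<bar>q \<omega>\<bar> = (\<infinity> :: ereal)"
    and lim_q: "\<And>\<omega>. \<omega> \<in> U \<Longrightarrow> (\<lambda>k. ereal (l k \<omega> * z k \<omega> $ c)) \<longlonglongrightarrow> q \<omega>"
    and bound: "AE \<omega> in M. \<omega> \<in> U \<longrightarrow> (\<exists>e<\<infinity>. (\<lambda>k. ennreal (l k \<omega>) * cexp (r c) (z k) \<omega>) \<longlonglongrightarrow> e)"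
  shows "U \<in> direction_sets c"
proof -
  interpret C: sigma_finite_subalgebra M "G (r c)" by (rule sigma_finite_subalgebra_G)
  note [measurable] = U l q(1)
  have UM[measurable]: "U \<in> sets M" using U by (rule sets_G)
  have fz[measurable]: "(\<lambda>\<omega>. f (z k \<omega>) \<omega>) \<in> borel_measurable M" for k
    using z pasted_measurable f_measurable by blast
  have zc[measurable]: "(\<lambda>\<omega>. z k \<omega> $ c) \<in> borel_measurable (G (r c))" for k
    using z by (rule pasted_component) simp
  \<comment> \<open>The lower bound \<open>1\<close> keeps the divisor positive everywhere; on
    \<open>U\<close> it is eventually inactive and \<open>m k \<omega>\<close> tends to
    infinity.\<close>
  define m where "m k \<omega> = max 1 \<bar>l k \<omega> * z k \<omega> $ c\<bar>" for k \<omega>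
  have m_pos: "m k \<omega> > 0" for k \<omega> by (simp add: m_def)
  have [measurable]: "m k \<in> borel_measurable (G (r c))" for k unfolding m_def by measurable
  define s where "s \<omega> = (if q \<omega> = \<infinity> then 1 else -1 :: real)" for \<omega>
  have [measurable]: "s \<in> borel_measurable (G (r c))" unfolding s_def by measurable
  \<comment> \<open>Only the entries of rank at most \<open>r c\<close> are prescribed by this
    target: earlier ones vanish in the limit, and entry \<open>c\<close> is eventually exactly
    \<open>s \<omega>\<close> on \<open>U\<close>. The later entries are supplied by
    \<open>closable (Suc (r c))\<close>.\<close>
  define x where "x \<omega> = (\<chi> b. if b = c then indicator U \<omega> * s \<omega> else 0)" for \<omega>
  have q_cases: "q \<omega> = \<infinity> \<or> q \<omega> = - \<infinity>" if "\<omega> \<in> U" for \<omega> using q(2)[OF that] by auto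
  have large: "\<forall>\<^sub>F k in sequentially. if q \<omega> = \<infinity> then K < l k \<omega> * z k \<omega> $ c else l k \<omega> * z k \<omega> $ c < - K"
    if "\<omega> \<in> U" for \<omega> K
  proof (cases "q \<omega> = \<infinity>")
    case True
    then have "\<forall>\<^sub>F k in sequentially. ereal K < ereal (l k \<omega> * z k \<omega> $ c)"
      using lim_q[OF that] by (simp add: tendsto_PInfty)
    then show ?thesis using True by simp
  next
    case False
    then have "(\<lambda>k. ereal (l k \<omega> * z k \<omega> $ c)) \<longlonglongrightarrow> - \<infinity>"
      using lim_q[OF that] q_cases[OF that] by simp
    then have "\<forall>\<^sub>F k in sequentially. ereal (l k \<omega> * z k \<omega> $ c) < ereal (- K)"
      by (rule tendsto_MInfty[THEN iffD1, rule_format])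
    then show ?thesis using False by simp
  qed
  have m_top: "filterlim (\<lambda>k. m k \<omega>) at_top sequentially" if "\<omega> \<in> U" for \<omega>
    unfolding filterlim_at_top_dense
  proof
    fix K show "\<forall>\<^sub>F k in sequentially. K < m k \<omega>"
      using large[OF that, of K] by eventually_elim (auto simp: m_def split: if_splits)
  qed
  have inv_m: "(\<lambda>k. 1 / m k \<omega>) \<longlonglongrightarrow> 0" if "\<omega> \<in> U" for \<omega>
    using m_top[OF that] by (auto intro: tendsto_divide_0[OF tendsto_const] filterlim_at_top_imp_at_infinity)
  have lim0: "(\<lambda>k. g k / m k \<omega>) \<longlonglongrightarrow> 0" if "\<omega> \<in> U" "convergent g" for \<omega> g
    using that m_top[OF that(1)] by (auto simp: convergent_def intro: tendsto_divide_0 filterlim_at_top_imp_at_infinity)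
  have lim_s: "(\<lambda>k. l k \<omega> / m k \<omega> * z k \<omega> $ c) \<longlonglongrightarrow> s \<omega>" if "\<omega> \<in> U" for \<omega>
  proof (rule tendsto_eventually)
    show "\<forall>\<^sub>F k in sequentially. l k \<omega> / m k \<omega> * z k \<omega> $ c = s \<omega>"
      using large[OF that, of 1] by eventually_elim (auto simp: m_def s_def max_def field_simps split: if_splits)
  qed
  obtain w \<phi> where w: "w \<in> adapted_strategies G r" and \<phi>[measurable]: "\<phi> \<in> borel_measurable M"
    and wx: "\<And>\<omega> b. r b < Suc (r c) \<Longrightarrow> w \<omega> $ b = x \<omega> $ b"
    and Hw: "\<And>\<omega>. \<omega> \<in> U \<Longrightarrow> H (w \<omega>) \<omega> \<le> \<phi> \<omega>"
    and le: "AE \<omega> in M. \<omega> \<in> U \<longrightarrow> nn_cond_exp M (G (Suc (r c))) \<phi> \<omega> \<le>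
        liminf (\<lambda>k. ennreal (l k \<omega> / m k \<omega>) * cexp (Suc (r c)) (z k) \<omega>)"
  proof (rule closableE[OF cl, of U z "\<lambda>k \<omega>. l k \<omega> / m k \<omega>" True x])
    show "U \<in> sets (G (Suc (r c)))" using U sets_G_mono[of "r c" "Suc (r c)"] by auto
    show "z k \<in> pasted (Suc (r c))" for k using z pasted_mono[of "r c" "Suc (r c)"] by auto
    show "(\<lambda>\<omega>. l k \<omega> / m k \<omega>) \<in> borel_measurable (G (Suc (r c)))" for k
      by (rule measurable_G_mono[of "r c"]) auto
    show "0 < l k \<omega> / m k \<omega>" for k \<omega> using pos m_pos by simp
    show "if True then (\<lambda>k. l k \<omega> / m k \<omega>) \<longlonglongrightarrow> 0 else \<forall>k. l k \<omega> / m k \<omega> = 1" if "\<omega> \<in> U" for \<omega>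
      using lim0[OF that conv_l[OF that]] by simp
    show "x \<in> adapted_strategies G r"
      unfolding adapted_strategies_def
    proof (intro CollectI allI)
      fix b show "(\<lambda>\<omega>. x \<omega> $ b) \<in> borel_measurable (G (r b))"
        by (cases "b = c") (auto simp: x_def)
    qed
    show "(\<lambda>k. l k \<omega> / m k \<omega> * z k \<omega> $ b) \<longlonglongrightarrow> x \<omega> $ b" if "\<omega> \<in> U" "r b < Suc (r c)" for \<omega> b
    proof (cases "b = c")
      case True
      then show ?thesis using lim_s that by (simp add: x_def)
    next
      case False
      then have "r b < r c" using that inj_r by (metis injD less_SucE)
      from lim0[OF that(1) conv[OF that(1) this]] False show ?thesis by (simp add: x_def)
    qed
  qed auto
  have w0: "w \<omega> $ b = 0" if "r b < r c" for \<omega> b using wx[of b] that by (auto simp: x_def)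
  have wc: "w \<omega> $ c = s \<omega>" if "\<omega> \<in> U" for \<omega> using wx[of c] that by (auto simp: x_def)
  have "AE \<omega> in M. \<omega> \<in> U \<longrightarrow> nn_cond_exp M (G (r c)) \<phi> \<omega> \<le>
        liminf (\<lambda>k. ennreal (l k \<omega> / m k \<omega>) * cexp (r c) (z k) \<omega>)"
    by (rule nn_cond_exp_tower_liminf[OF sigma_finite_subalgebra_G sigma_finite_subalgebra_G subalgebra_G U \<phi> fz _ le])
      auto
  with bound have "AE \<omega> in M. \<omega> \<in> U \<longrightarrow> nn_cond_exp M (G (r c)) \<phi> \<omega> = 0"
  proof eventually_elim
    case (elim \<omega>)
    show ?case
    proof
      assume \<omega>: "\<omega> \<in> U"
      then obtain e where e: "e < \<infinity>" "(\<lambda>k. ennreal (l k \<omega>) * cexp (r c) (z k) \<omega>) \<longlonglongrightarrow> e"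
        using elim by auto
      \<comment> \<open>Finiteness of \<open>e\<close> is essential for the product of limits to be
        zero, since a vanishing factor times an infinite limit is indeterminate.\<close>
      have "(\<lambda>k. ennreal (1 / m k \<omega>)) \<longlonglongrightarrow> ennreal 0" by (intro tendsto_ennrealI inv_m \<omega>)
      then have "(\<lambda>k. ennreal (1 / m k \<omega>) * (ennreal (l k \<omega>) * cexp (r c) (z k) \<omega>)) \<longlonglongrightarrow> ennreal 0 * e"
        using e by (intro tendsto_mult_ennreal) auto
      moreover have "ennreal (1 / m k \<omega>) * (ennreal (l k \<omega>) * cexp (r c) (z k) \<omega>) =
          ennreal (l k \<omega> / m k \<omega>) * cexp (r c) (z k) \<omega>" for k
        using pos[of k \<omega>] m_pos[of k \<omega>] by (simp add: mult.assoc[symmetric] ennreal_mult[symmetric])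
      ultimately have "(\<lambda>k. ennreal (l k \<omega> / m k \<omega>) * cexp (r c) (z k) \<omega>) \<longlonglongrightarrow> 0" by simp
      from lim_imp_Liminf[OF _ this] elim \<omega> show "nn_cond_exp M (G (r c)) \<phi> \<omega> = 0" by simp
    qed
  qed
  then have "(\<integral>\<^sup>+\<omega>\<in>U. nn_cond_exp M (G (r c)) \<phi> \<omega> \<partial>M) = 0"
    by (subst nn_integral_0_iff_AE) (auto elim!: eventually_mono simp: indicator_def)
  then have "(\<integral>\<^sup>+\<omega>\<in>U. \<phi> \<omega> \<partial>M) = 0" using C.nn_cond_exp_set_integral[OF U \<phi>] by simp
  then have \<phi>0: "AE \<omega> in M. \<omega> \<in> U \<longrightarrow> \<phi> \<omega> = 0"
    by (subst (asm) nn_integral_0_iff_AE) (auto elim!: eventually_mono simp: indicator_def split: if_splits)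
  \<comment> \<open>\<open>H\<close> is controlled along \<open>w\<close> only on \<open>U\<close>.
    Restricting to \<open>U\<close> leaves zero elsewhere, where \<open>H_zero\<close> applies, so
    the recession condition holds almost surely on the whole space.\<close>
  define v where "v \<omega> = indicator U \<omega> *\<^sub>R w \<omega>" for \<omega>
  have v: "v \<in> adapted_strategies G r"
    unfolding v_def by (rule adapted_scale[OF w w0]) auto
  have "AE \<omega> in M. H (v \<omega>) \<omega> = 0"
    using \<phi>0 H_zero
  proof eventually_elim
    case (elim \<omega>)
    then show ?case using Hw[of \<omega>] by (cases "\<omega> \<in> U") (auto simp: v_def)
  qed
  with v w0 recession_N[OF v] have "v \<in> directions (r c)"
    by (auto simp: directions_def v_def)
  \<comment> \<open>Multiplying by the sign turns the entry \<open>s \<omega>\<close> into its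
    square, \<open>1\<close>.\<close>
  then have "(\<lambda>\<omega>. s \<omega> *\<^sub>R v \<omega>) \<in> directions (r c)" by (rule directions_scale) simp
  moreover have "(s \<omega> *\<^sub>R v \<omega>) $ c = 1" if "\<omega> \<in> U" for \<omega>
    using wc[OF that] that by (simp add: v_def s_def)
  ultimately show ?thesis using U unfolding direction_sets_def
    by (intro CollectI conjI bexI[of _ "\<lambda>\<omega>. s \<omega> *\<^sub>R v \<omega>"] ballI)
qed

text \<open>The subsequence is extracted twice: \<tau> brings the conditional cost to its lower
  limit \<open>e\<close>, then \<sigma> makes coordinate \<open>c\<close> converge in the extended
  reals without disturbing \<open>e\<close> or the earlier coordinates. Both use only
  \<open>G (r c)\<close>, so the selection stays pasted at that rank.\<close>

lemma closable_step:
  assumes cl: "closable (Suc (r c))"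
  shows "closable (r c)"
  unfolding closable_def
proof (intro allI impI)
  fix rec D z l x
  assume D[measurable]: "D \<in> sets (G (r c))" and z: "\<forall>k. z k \<in> pasted (r c)"
    and l: "\<forall>k::nat. l k \<in> borel_measurable (G (r c))" and pos: "\<forall>k \<omega>. 0 < (l k \<omega> :: real)"
    and lim: "\<forall>\<omega>\<in>D. if rec then (\<lambda>k. l k \<omega>) \<longlonglongrightarrow> 0 else (\<forall>k. l k \<omega> = 1)"
    and x: "x \<in> adapted_strategies G r"
    and conv: "\<forall>\<omega>\<in>D. \<forall>b. r b < r c \<longrightarrow> (\<lambda>k. l k \<omega> * z k \<omega> $ b) \<longlonglongrightarrow> x \<omega> $ b"
  interpret C: sigma_finite_subalgebra M "G (r c)" by (rule sigma_finite_subalgebra_G)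
  have spD: "\<omega> \<in> space (G (r c))" if "\<omega> \<in> D" for \<omega> using D that sets.sets_into_space by blast
  have lm[measurable]: "l k \<in> borel_measurable (G (r c))" for k using l by simp
  obtain C w where C[measurable]: "C \<in> sets (G (r c))" and w: "w \<in> directions (r c)"
    and wC: "\<And>\<omega>. \<omega> \<in> C \<Longrightarrow> w \<omega> $ c = 1"
    and max: "\<And>C'. C' \<in> direction_sets c \<Longrightarrow> C' \<inter> C = {} \<Longrightarrow> C' \<in> null_sets M"
    using ex_maximal_direction_set[of c] by blast
  have zm[measurable]: "(\<lambda>\<omega>. z k \<omega> $ c) \<in> borel_measurable (G (r c))" for k
    using z by (intro pasted_component) auto
  \<comment> \<open>Moving along \<open>w\<close> costs nothing, so coordinate \<open>c\<close> may be set to \<open>0\<close> on \<open>C\<close>; off \<open>C\<close> no recession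
    direction is left.\<close>
  define z' where "z' k \<omega> = z k \<omega> + (- indicator C \<omega> * z k \<omega> $ c) *\<^sub>R w \<omega>" for k \<omega>
  have wd: "(\<lambda>\<omega>. (- indicator C \<omega> * z k \<omega> $ c) *\<^sub>R w \<omega>) \<in> directions (r c)" for k
    by (rule directions_scale[OF w]) auto
  have z': "z' k \<in> pasted (r c)" for k
    unfolding z'_def using z wd by (intro pasted_add) auto
  have z'_cexp: "AE \<omega> in M. \<forall>k. cexp (r c) (z' k) \<omega> = cexp (r c) (z k) \<omega>"
    unfolding z'_def AE_all_countable using z wd by (intro allI pasted_add(2)) auto
  have z'C: "z' k \<omega> $ c = 0" if "\<omega> \<in> C" for k \<omega> using wC[OF that] that by (simp add: z'_def)
  have z'b: "z' k \<omega> $ b = z k \<omega> $ b" if "r b < r c" for k \<omega> b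
    using w that by (simp add: z'_def directions_def)
  have z'm[measurable]: "(\<lambda>\<omega>. z' k \<omega> $ c) \<in> borel_measurable (G (r c))" for k
    using z' by (rule pasted_component) simp

  define a where "a k \<omega> = ennreal (l k \<omega>) * cexp (r c) (z' k) \<omega>" for k \<omega>
  have [measurable]: "a k \<in> borel_measurable (G (r c))" for k unfolding a_def by measurable
  define e where "e \<omega> = liminf (\<lambda>k. a k \<omega>)" for \<omega>
  have [measurable]: "e \<in> borel_measurable (G (r c))" unfolding e_def by measurable
  obtain \<tau> where \<tau>: "\<And>k. \<tau> k \<in> measurable (G (r c)) (count_space UNIV)"
    "\<And>\<omega>. \<omega> \<in> space (G (r c)) \<Longrightarrow> strict_mono (\<lambda>k. \<tau> k \<omega>)"
    "\<And>\<omega>. \<omega> \<in> space (G (r c)) \<Longrightarrow> (\<lambda>k. a (\<tau> k \<omega>) \<omega>) \<longlonglongrightarrow> e \<omega>"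
    using measurable_subsequence_liminf[of a "G (r c)"] unfolding e_def by auto
  define v where "v k \<omega> = ereal (l (\<tau> k \<omega>) \<omega> * z' (\<tau> k \<omega>) \<omega> $ c)" for k \<omega>
  have vm[measurable]: "v k \<in> borel_measurable (G (r c))" for k
    unfolding v_def by (rule measurable_compose_countable[OF _ \<tau>(1)]) measurable
  define q where "q \<omega> = liminf (\<lambda>k. v k \<omega>)" for \<omega>
  have qm[measurable]: "q \<in> borel_measurable (G (r c))" unfolding q_def by measurable
  obtain \<sigma> where \<sigma>: "\<And>k. \<sigma> k \<in> measurable (G (r c)) (count_space UNIV)"
    "\<And>\<omega>. \<omega> \<in> space (G (r c)) \<Longrightarrow> strict_mono (\<lambda>k. \<sigma> k \<omega>)"
    "\<And>\<omega>. \<omega> \<in> space (G (r c)) \<Longrightarrow> (\<lambda>k. v (\<sigma> k \<omega>) \<omega>) \<longlonglongrightarrow> q \<omega>"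
    using measurable_subsequence_liminf[of v "G (r c)"] unfolding q_def by auto
  define \<rho> where "\<rho> k \<omega> = \<tau> (\<sigma> k \<omega>) \<omega>" for k \<omega>
  have \<rho>[measurable]: "\<rho> k \<in> measurable (G (r c)) (count_space UNIV)" for k
    unfolding \<rho>_def by (rule measurable_compose_countable[OF \<tau>(1) \<sigma>(1)])
  have \<rho>_mono: "strict_mono (\<lambda>k. \<rho> k \<omega>)" if "\<omega> \<in> space (G (r c))" for \<omega>
    using \<tau>(2)[OF that] \<sigma>(2)[OF that] by (simp add: \<rho>_def strict_mono_def)
  have sub: "(\<lambda>k. g (\<rho> k \<omega>)) \<longlonglongrightarrow> t" if "\<omega> \<in> D" "g \<longlonglongrightarrow> t" for g :: "nat \<Rightarrow> real" and t \<omega>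
    using LIMSEQ_subseq_LIMSEQ[OF that(2) \<rho>_mono[OF spD[OF that(1)]]] by (simp add: o_def)
  have lim_a: "(\<lambda>k. a (\<rho> k \<omega>) \<omega>) \<longlonglongrightarrow> e \<omega>" if "\<omega> \<in> D" for \<omega>
    using LIMSEQ_subseq_LIMSEQ[OF \<tau>(3) \<sigma>(2), of \<omega> \<omega>] spD[OF that] by (simp add: o_def \<rho>_def)

  define Z where "Z k \<omega> = z' (\<rho> k \<omega>) \<omega>" for k \<omega>
  define L where "L k \<omega> = l (\<rho> k \<omega>) \<omega>" for k \<omega>
  have Z: "Z k \<in> pasted (r c)" for k unfolding Z_def by (rule pasted_select[OF z' \<rho>])
  have L[measurable]: "L k \<in> borel_measurable (G (r c))" for k
    unfolding L_def by (rule measurable_compose_countable[OF lm \<rho>])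
  have Lpos: "L k \<omega> > 0" for k \<omega> using pos by (simp add: L_def)
  have L_lim: "if rec then (\<lambda>k. L k \<omega>) \<longlonglongrightarrow> 0 else (\<forall>k. L k \<omega> = 1)" if "\<omega> \<in> D" for \<omega>
    using lim that sub[OF that, of "\<lambda>k. l k \<omega>" 0] by (auto simp: L_def)
  have LZ: "(\<lambda>k. L k \<omega> * Z k \<omega> $ b) \<longlonglongrightarrow> x \<omega> $ b" if "\<omega> \<in> D" "r b < r c" for \<omega> b
    using conv that sub[OF that(1), of "\<lambda>k. l k \<omega> * z k \<omega> $ b" "x \<omega> $ b"]
    by (auto simp: L_def Z_def z'b)
  have LZc: "(\<lambda>k. ereal (L k \<omega> * Z k \<omega> $ c)) \<longlonglongrightarrow> q \<omega>" if "\<omega> \<in> D" for \<omega>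
    using \<sigma>(3)[OF spD[OF that]] by (simp add: v_def L_def Z_def \<rho>_def)
  have "AE \<omega> in M. \<forall>k. cexp (r c) (Z k) \<omega> = cexp (r c) (z' (\<rho> k \<omega>)) \<omega>"
    unfolding AE_all_countable Z_def by (intro allI cexp_select z' \<rho>)
  then have Le: "AE \<omega> in M. \<omega> \<in> D \<longrightarrow> (\<lambda>k. ennreal (L k \<omega>) * cexp (r c) (Z k) \<omega>) \<longlonglongrightarrow> e \<omega>"
    by eventually_elim (use lim_a in \<open>simp add: a_def L_def\<close>)

  \<comment> \<open>Where \<open>e\<close> is infinite the required bound is trivial, so only the
    part of \<open>D\<close> with finite \<open>e\<close> is split: \<open>U\<close> is the
    unbounded event to be excluded, \<open>B\<close> the event with a finite limit for coordinate
    \<open>c\<close>.\<close>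
  define U where "U = {\<omega> \<in> space (G (r c)). \<omega> \<in> D \<and> e \<omega> < \<infinity> \<and> \<bar>q \<omega>\<bar> = \<infinity>}"
  define B where "B = {\<omega> \<in> space (G (r c)). \<omega> \<in> D \<and> e \<omega> < \<infinity> \<and> \<bar>q \<omega>\<bar> \<noteq> \<infinity>}"
  have U: "U \<in> sets (G (r c))" unfolding U_def by measurable
  have B[measurable]: "B \<in> sets (G (r c))" unfolding B_def by measurable
  have "U \<in> direction_sets c"
  proof (rule unbounded_direction_set[OF cl U Z L Lpos])
    show "convergent (\<lambda>k. L k \<omega>)" if "\<omega> \<in> U" for \<omega>
      using L_lim[of \<omega>] that by (auto simp: U_def convergent_def split: if_splits)
    show "convergent (\<lambda>k. L k \<omega> * Z k \<omega> $ b)" if "\<omega> \<in> U" "r b < r c" for \<omega> b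
      using LZ[of \<omega> b] that by (auto simp: U_def convergent_def)
    show "AE \<omega> in M. \<omega> \<in> U \<longrightarrow> (\<exists>e<\<infinity>. (\<lambda>k. ennreal (L k \<omega>) * cexp (r c) (Z k) \<omega>) \<longlonglongrightarrow> e)"
      using Le by eventually_elim (auto simp: U_def)
  qed (use LZc in \<open>auto simp: U_def\<close>)
  moreover have "U \<inter> C = {}"
  proof -
    have "q \<omega> = 0" if "\<omega> \<in> U" "\<omega> \<in> C" for \<omega>
      using LZc[of \<omega>] that z'C by (auto simp: U_def Z_def LIMSEQ_const_iff zero_ereal_def[symmetric])
    then show ?thesis by (force simp: U_def)
  qed
  ultimately have "U \<in> null_sets M" by (rule max)
  then have notU: "AE \<omega> in M. \<omega> \<notin> U" by (rule AE_not_in)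

  \<comment> \<open>The default \<open>0\<close> off \<open>B\<close> keeps the new target
    real-valued and measurable where \<open>q\<close> is infinite or no convergence is
    claimed.\<close>
  define x' where "x' \<omega> = (\<chi> b. if b = c then indicator B \<omega> * real_of_ereal (q \<omega>) else x \<omega> $ b)" for \<omega>
  obtain y \<phi> where y: "y \<in> adapted_strategies G r" and \<phi>[measurable]: "\<phi> \<in> borel_measurable M"
    and yx: "\<And>\<omega> b. r b < Suc (r c) \<Longrightarrow> y \<omega> $ b = x' \<omega> $ b"
    and Hy: "\<And>\<omega>. \<omega> \<in> B \<Longrightarrow> (if rec then H else f) (y \<omega>) \<omega> \<le> \<phi> \<omega>"
    and le: "AE \<omega> in M. \<omega> \<in> B \<longrightarrow> nn_cond_exp M (G (Suc (r c))) \<phi> \<omega> \<le>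
        liminf (\<lambda>k. ennreal (L k \<omega>) * cexp (Suc (r c)) (Z k) \<omega>)"
  proof (rule closableE[OF cl, of B Z L rec x'])
    show "B \<in> sets (G (Suc (r c)))" using B sets_G_mono[of "r c" "Suc (r c)"] by auto
    show "Z k \<in> pasted (Suc (r c))" for k using Z pasted_mono[of "r c" "Suc (r c)"] by auto
    show "L k \<in> borel_measurable (G (Suc (r c)))" for k
      by (rule measurable_G_mono[of "r c"]) auto
    show "if rec then (\<lambda>k. L k \<omega>) \<longlonglongrightarrow> 0 else (\<forall>k. L k \<omega> = 1)" if "\<omega> \<in> B" for \<omega>
      using L_lim[of \<omega>] that by (auto simp: B_def)
    show "x' \<in> adapted_strategies G r"
      unfolding adapted_strategies_def
    proof (intro CollectI allI)
      fix b show "(\<lambda>\<omega>. x' \<omega> $ b) \<in> borel_measurable (G (r b))"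
        using x by (cases "b = c") (auto simp: x'_def adapted_strategies_def)
    qed
    show "(\<lambda>k. L k \<omega> * Z k \<omega> $ b) \<longlonglongrightarrow> x' \<omega> $ b" if "\<omega> \<in> B" "r b < Suc (r c)" for \<omega> b
    proof (cases "b = c")
      case True
      have "(\<lambda>k. ereal (L k \<omega> * Z k \<omega> $ c)) \<longlonglongrightarrow> ereal (real_of_ereal (q \<omega>))"
        using LZc[of \<omega>] that by (auto simp: B_def ereal_real)
      then show ?thesis using True that by (simp add: x'_def)
    next
      case False
      then have "r b < r c" using that inj_r by (metis injD less_SucE)
      from LZ[OF _ this, of \<omega>] that False show ?thesis by (simp add: x'_def B_def)
    qed
  qed (use Lpos in auto)
  have BM[measurable]: "B \<in> sets M" using B by (rule sets_G)
  have fZ: "(\<lambda>\<omega>. f (Z k \<omega>) \<omega>) \<in> borel_measurable M" for k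
    using Z pasted_measurable f_measurable by blast
  have le': "AE \<omega> in M. \<omega> \<in> B \<longrightarrow> nn_cond_exp M (G (r c)) \<phi> \<omega> \<le>
        liminf (\<lambda>k. ennreal (L k \<omega>) * cexp (r c) (Z k) \<omega>)"
    by (rule nn_cond_exp_tower_liminf[OF sigma_finite_subalgebra_G sigma_finite_subalgebra_G subalgebra_G B \<phi> fZ _ le])
      auto
  \<comment> \<open>The strategy \<open>y\<close> is controlled only on \<open>B\<close>, but its
    cost must be dominated at every point of \<open>D\<close>. The value infinity settles the rest;
    since \<open>B\<close> is in \<open>G (r c)\<close>, the conditional expectation on
    \<open>B\<close> is unaffected, and on \<open>D\<close> off \<open>B\<close> the right-hand side
    is infinite almost surely.\<close>
  define \<psi> where "\<psi> \<omega> = (if \<omega> \<in> B then \<phi> \<omega> else \<infinity>)" for \<omega>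
  have \<psi>[measurable]: "\<psi> \<in> borel_measurable M" unfolding \<psi>_def by measurable
  have "AE \<omega> in M. \<omega> \<in> B \<longrightarrow> nn_cond_exp M (G (r c)) \<psi> \<omega> = nn_cond_exp M (G (r c)) \<phi> \<omega>"
    by (rule C.nn_cond_exp_local[OF B]) (auto simp: \<psi>_def)
  then have main: "AE \<omega> in M. \<omega> \<in> D \<longrightarrow>
        nn_cond_exp M (G (r c)) \<psi> \<omega> \<le> liminf (\<lambda>k. ennreal (l k \<omega>) * cexp (r c) (z k) \<omega>)"
    using le' Le z'_cexp notU
  proof eventually_elim
    case (elim \<omega>)
    have e: "liminf (\<lambda>k. ennreal (l k \<omega>) * cexp (r c) (z k) \<omega>) = e \<omega>"
      unfolding e_def a_def using elim by simp
    show ?case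
    proof
      assume \<omega>: "\<omega> \<in> D"
      show "nn_cond_exp M (G (r c)) \<psi> \<omega> \<le> liminf (\<lambda>k. ennreal (l k \<omega>) * cexp (r c) (z k) \<omega>)"
      proof (cases "e \<omega> < \<infinity>")
        case True
        then have "\<omega> \<in> B" using elim \<omega> spD by (auto simp: U_def B_def)
        moreover have "liminf (\<lambda>k. ennreal (L k \<omega>) * cexp (r c) (Z k) \<omega>) = e \<omega>"
          using elim \<omega> by (intro lim_imp_Liminf) auto
        ultimately show ?thesis using elim by (simp add: e)
      next
        case False
        then show ?thesis by (simp add: e less_top[symmetric])
      qed
    qed
  qed
  show "\<exists>y\<in>adapted_strategies G r. \<exists>\<phi>\<in>borel_measurable M.
      (\<forall>\<omega> b. r b < r c \<longrightarrow> y \<omega> $ b = x \<omega> $ b) \<and>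
      (\<forall>\<omega>\<in>D. (if rec then H else f) (y \<omega>) \<omega> \<le> \<phi> \<omega>) \<and>
      (AE \<omega> in M. \<omega> \<in> D \<longrightarrow>
        nn_cond_exp M (G (r c)) \<phi> \<omega> \<le> liminf (\<lambda>k. ennreal (l k \<omega>) * cexp (r c) (z k) \<omega>))"
  proof (intro bexI[OF _ y] bexI[OF _ \<psi>] conjI allI impI ballI)
    fix \<omega> b assume "r b < r c"
    then show "y \<omega> $ b = x \<omega> $ b" using yx[of b] by (auto simp: x'_def)
  next
    fix \<omega> assume "\<omega> \<in> D"
    show "(if rec then H else f) (y \<omega>) \<omega> \<le> \<psi> \<omega>" using Hy[of \<omega>] by (auto simp: \<psi>_def)
  qed (rule main)
qed

lemma closable_0: "closable 0"
proof -
  have "i \<le> d \<Longrightarrow> closable i" for i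
  proof (induction i rule: inc_induct)
    case base
    show ?case by (rule closable_d)
  next
    case (step i)
    then obtain c where "r c = i" using range_r by (metis imageE lessThan_iff)
    with closable_step[of c] step show ?case by simp
  qed
  then show ?thesis by simp
qed

lemma ex_minimizer:
  "\<exists>y\<in>adapted_strategies G r. (\<integral>\<^sup>+\<omega>. f (y \<omega>) \<omega> \<partial>M) =
    (INF x\<in>adapted_strategies G r. \<integral>\<^sup>+\<omega>. f (x \<omega>) \<omega> \<partial>M)"
proof -
  interpret C: sigma_finite_subalgebra M "G 0" by (rule sigma_finite_subalgebra_G)
  let ?A = "adapted_strategies G r"
  let ?I = "\<lambda>x. \<integral>\<^sup>+\<omega>. f (x \<omega>) \<omega> \<partial>M"
  have zero: "(\<lambda>_. 0) \<in> ?A" by (simp add: adapted_strategies_def)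
  define j where "j = (INF x\<in>?A. ?I x)"
  have j_le: "j \<le> ?I x" if "x \<in> ?A" for x unfolding j_def using that by (rule INF_lower)
  show ?thesis
  proof (cases "j < \<infinity>")
    case False
    then have "j = \<infinity>" by (simp add: less_top[symmetric])
    then show ?thesis using j_le[OF zero] zero unfolding j_def[symmetric] by (auto simp: top_unique)
  next
    case True
    have "\<exists>x\<in>?A. ?I x < j + ennreal (1 / Suc k)" for k
    proof -
      have "j < j + ennreal (1 / Suc k)" using True ennreal_add_left_cancel_less[of j 0 "ennreal (1 / Suc k)"] by simp
      then show ?thesis unfolding j_def by (simp add: INF_less_iff)
    qed
    then obtain x where x: "\<And>k. x k \<in> ?A" "\<And>k. ?I (x k) < j + ennreal (1 / Suc k)" by metis
    have xf: "x k \<in> finite_strategies" for k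
    proof -
      have "j + ennreal (1 / Suc k) < \<infinity>" using True by simp
      with x[of k] show ?thesis unfolding finite_strategies_def by (auto intro: less_trans)
    qed
    \<comment> \<open>At rank \<open>0\<close> no coordinate is prescribed, so the zero target is a
      dummy and an arbitrary minimising sequence of finite cost is allowed.\<close>
    obtain y \<phi> where y: "y \<in> ?A" and \<phi>[measurable]: "\<phi> \<in> borel_measurable M"
      and fy: "\<And>\<omega>. \<omega> \<in> space M \<Longrightarrow> f (y \<omega>) \<omega> \<le> \<phi> \<omega>"
      and le: "AE \<omega> in M. \<omega> \<in> space M \<longrightarrow> nn_cond_exp M (G 0) \<phi> \<omega> \<le> liminf (\<lambda>k. ennreal 1 * cexp 0 (x k) \<omega>)"
      by (rule closableE[OF closable_0, of "space M" x "\<lambda>_ _. 1" False "\<lambda>_. 0"])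
        (use xf zero finite_strategies_pasted sets.top[of "G 0"] in \<open>auto simp: space_G\<close>)
    have fx: "(\<lambda>\<omega>. f (x k \<omega>) \<omega>) \<in> borel_measurable M" for k
      using x adapted_measurable f_measurable by blast
    have lim: "(\<lambda>k. j + ennreal (1 / Suc k)) \<longlonglongrightarrow> j + ennreal 0"
      by (intro tendsto_add tendsto_const tendsto_ennrealI LIMSEQ_inverse_real_of_nat[unfolded inverse_eq_divide])
    have tot: "(\<integral>\<^sup>+\<omega>. nn_cond_exp M (G 0) g \<omega> \<partial>M) = (\<integral>\<^sup>+\<omega>. g \<omega> \<partial>M)"
      if "g \<in> borel_measurable M" for g
      using C.nn_cond_exp_intg[of "\<lambda>_. 1" g] that by simp
    have "?I y \<le> (\<integral>\<^sup>+\<omega>. \<phi> \<omega> \<partial>M)" using fy by (rule nn_integral_mono)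
    also have "\<dots> = (\<integral>\<^sup>+\<omega>. nn_cond_exp M (G 0) \<phi> \<omega> \<partial>M)" by (simp add: tot)
    also have "\<dots> \<le> (\<integral>\<^sup>+\<omega>. liminf (\<lambda>k. cexp 0 (x k) \<omega>) \<partial>M)"
      using le AE_space by (intro nn_integral_mono_AE) (auto elim!: eventually_elim2)
    also have "\<dots> \<le> liminf (\<lambda>k. \<integral>\<^sup>+\<omega>. cexp 0 (x k) \<omega> \<partial>M)"
      by (rule nn_integral_liminf) auto
    also have "\<dots> = liminf (\<lambda>k. ?I (x k))" by (simp add: tot[OF fx])
    also have "\<dots> \<le> liminf (\<lambda>k. j + ennreal (1 / Suc k))"
      using x by (intro Liminf_mono always_eventually allI less_imp_le)
    also have "\<dots> = j" using lim_imp_Liminf[OF _ lim] by simp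
    finally show ?thesis using y j_le[OF y] unfolding j_def[symmetric] by (auto intro: antisym)
  qed
qed

end

section \<open>Horizon functions and the existence theorem\<close>

lemma e2ennreal_liminf: "e2ennreal (liminf X) = liminf (\<lambda>k. e2ennreal (X k))"
  by (rule Liminf_compose_continuous_mono[symmetric]) (auto simp: mono_def e2ennreal_mono continuous_on_e2ennreal)

lemma e2ennreal_eq_0_iff: "e2ennreal x = 0 \<longleftrightarrow> x \<le> 0"
  by (cases x) (auto simp: ennreal_eq_0_iff e2ennreal_neg)

lemma ennreal_mult_e2ennreal: "0 < l \<Longrightarrow> ennreal l * e2ennreal a = e2ennreal (ereal l * a)"
proof (cases a)
  case (real s)
  assume "0 < l"
  then show ?thesis using real
    by (cases "s \<ge> 0") (auto simp: ennreal_mult ennreal_neg mult_nonneg_nonpos)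
qed (auto simp: ennreal_mult_top e2ennreal_neg)

lemma lower_semicontinuous_liminf:
  fixes g :: "'b::topological_space \<Rightarrow> ereal"
  assumes "lower_semicontinuous g" "z \<longlonglongrightarrow> y"
  shows "g y \<le> liminf (\<lambda>k. g (z k))"
  unfolding le_Liminf_iff
proof (intro allI impI)
  fix t assume t: "t < g y"
  have "g y \<le> Liminf (at y) g" using assms(1) by (simp add: lower_semicontinuous_def)
  with t have "\<forall>\<^sub>F x in at y. t < g x" by (auto simp: le_Liminf_iff)
  \<comment> \<open>The limit inferior at \<open>y\<close> ignores \<open>y\<close> itself;
    \<open>t < g y\<close> fills the gap, so sequences that hit \<open>y\<close> are
    covered.\<close>
  then have "\<forall>\<^sub>F x in nhds y. t < g x" using t
    unfolding eventually_at_filter by (auto elim!: eventually_mono)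
  then show "\<forall>\<^sub>F k in sequentially. t < g (z k)"
    using assms(2) by (rule eventually_compose_filterlim)
qed

text \<open>For each fixed \<delta>, the pairs \<open>(l k, l k *\<^sub>R z k)\<close> eventually
  belong to the index set of the infimum, so the infimum is below the tail of the sequence.\<close>

lemma horizon_le_liminf:
  fixes g :: "'b::real_normed_vector \<Rightarrow> ereal"
  assumes pos: "\<And>k::nat. l k > 0" and l: "l \<longlonglongrightarrow> 0" and z: "(\<lambda>k. l k *\<^sub>R z k) \<longlonglongrightarrow> w"
  shows "horizon g w \<le> liminf (\<lambda>k. ereal (l k) * g (z k))"
proof (rule tendsto_upperbound[OF tendsto_horizon])
  show "\<forall>\<^sub>F \<delta>::real in at_right 0. (INF (l, w')\<in>{0<..<\<delta>} \<times> cball w \<delta>. ereal l * g (w' /\<^sub>R l)) \<le>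
      liminf (\<lambda>k. ereal (l k) * g (z k))"
    using eventually_at_right_less[of 0]
  proof eventually_elim
    case (elim \<delta>)
    have "\<forall>\<^sub>F k in sequentially. l k < \<delta>" using l elim by (rule order_tendstoD)
    moreover have "\<forall>\<^sub>F k in sequentially. dist (l k *\<^sub>R z k) w < \<delta>" using z elim by (rule tendstoD)
    ultimately show ?case
    proof (intro Liminf_bounded, eventually_elim)
      case (elim k)
      then have "(l k, l k *\<^sub>R z k) \<in> {0<..<\<delta>} \<times> cball w \<delta>" using pos by (simp add: dist_commute)
      then have "(INF (l, w')\<in>{0<..<\<delta>} \<times> cball w \<delta>. ereal l * g (w' /\<^sub>R l)) \<le>
          (case (l k, l k *\<^sub>R z k) of (l, w') \<Rightarrow> ereal l * g (w' /\<^sub>R l))"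
        by (rule INF_lower)
      then show ?case using pos[of k] by simp
    qed
  qed
qed simp

lemma ereal_expectation_shift:
  assumes g[measurable]: "g \<in> borel_measurable M" and m: "integrable M m"
    and le: "AE \<omega> in M. ereal (m \<omega>) \<le> g \<omega>"
  shows "ereal_expectation M g =
    enn2ereal (\<integral>\<^sup>+\<omega>. e2ennreal (ereal (- m \<omega>) + g \<omega>) \<partial>M) + ereal (\<integral>\<omega>. m \<omega> \<partial>M)"
proof -
  have [measurable]: "m \<in> borel_measurable M" using m by simp
  let ?A = "\<integral>\<^sup>+\<omega>. e2ennreal (g \<omega>) \<partial>M" and ?B = "\<integral>\<^sup>+\<omega>. e2ennreal (- g \<omega>) \<partial>M"
  let ?P = "\<integral>\<^sup>+\<omega>. ennreal (m \<omega>) \<partial>M" and ?Q = "\<integral>\<^sup>+\<omega>. ennreal (- m \<omega>) \<partial>M"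
  let ?I = "\<integral>\<^sup>+\<omega>. e2ennreal (ereal (- m \<omega>) + g \<omega>) \<partial>M"
  have P: "?P \<noteq> \<infinity>" and Q: "?Q \<noteq> \<infinity>" using m by (auto simp: real_integrable_def)
  have "?B \<le> ?Q"
    using le by (intro nn_integral_mono_AE, eventually_elim)
      (metis e2ennreal_ereal e2ennreal_mono ereal_minus_le_minus uminus_ereal.simps(1))
  with Q have B: "?B \<noteq> \<infinity>" by (auto simp: top_unique)
  \<comment> \<open>The identity \<open>y = (y - s) + s\<close> is rearranged so that only
    nonnegative parts are added. It can then be integrated without meeting a difference of
    infinities, and the finite integrals are subtracted at the end.\<close>
  have pw: "e2ennreal y + ennreal (- s) = e2ennreal (ereal (- s) + y) + (ennreal s + e2ennreal (- y))"
    if "ereal s \<le> y" for s y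
  proof (cases y)
    case (real u)
    with that have "s \<le> u" by simp
    consider "0 \<le> s" | "s < 0" "0 \<le> u" | "u < 0" using \<open>s \<le> u\<close> by linarith
    then show ?thesis
      using real \<open>s \<le> u\<close>
      by cases (auto simp: ennreal_neg ennreal_plus[symmetric] simp del: ennreal_plus)
  qed (use that in auto)
  have "?A + ?Q = (\<integral>\<^sup>+\<omega>. e2ennreal (g \<omega>) + ennreal (- m \<omega>) \<partial>M)"
    by (intro nn_integral_add[symmetric]) auto
  also have "\<dots> = (\<integral>\<^sup>+\<omega>. e2ennreal (ereal (- m \<omega>) + g \<omega>) + (ennreal (m \<omega>) + e2ennreal (- g \<omega>)) \<partial>M)"
    using le by (intro nn_integral_cong_AE, eventually_elim) (rule pw)
  also have "\<dots> = ?I + (?P + ?B)"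
    by (simp add: nn_integral_add)
  finally have eq: "?A + ?Q = ?I + (?P + ?B)" .
  obtain p where p: "?P = ennreal p" "p \<ge> 0" using P by (cases ?P) auto
  obtain q where q: "?Q = ennreal q" "q \<ge> 0" using Q by (cases ?Q) auto
  obtain b where b: "?B = ennreal b" "b \<ge> 0" using B by (cases ?B) auto
  have int: "(\<integral>\<omega>. m \<omega> \<partial>M) = p - q"
    using real_lebesgue_integral_def[OF m] p q by simp
  show ?thesis
  proof (cases ?I)
    case (real i)
    then have "?A + ?Q = ennreal (i + p + b)"
      using eq p b by (simp add: ennreal_plus[symmetric] add.assoc del: ennreal_plus)
    moreover then obtain a where a: "?A = ennreal a" "a \<ge> 0" by (cases ?A) auto
    ultimately have "ennreal (a + q) = ennreal (i + p + b)" using q by simp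
    then have "a + q = i + p + b" using a q real p b by (subst (asm) ennreal_inj) auto
    then show ?thesis unfolding ereal_expectation_def int a b real using a b real
      by simp
  next
    case top
    then have "?A = \<infinity>" using eq Q by (auto simp: ennreal_add_eq_top)
    then show ?thesis unfolding ereal_expectation_def int b using top b by simp
  qed
qed

lemma ex_stage_ranking:
  fixes stage :: "'n::finite \<Rightarrow> nat"
  obtains r :: "'n \<Rightarrow> nat" where "inj r" "range r = {..<CARD('n)}"
    "\<And>a b. stage a < stage b \<Longrightarrow> r a < r b"
proof -
  obtain idx :: "'n \<Rightarrow> nat" where idx: "bij_betw idx UNIV {..<CARD('n)}"
    using ex_bij_betw_finite_nat[of "UNIV :: 'n set"] by (auto simp: lessThan_atLeast0)
  then have lt: "idx a < CARD('n)" for a by (auto simp: bij_betw_def)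
  \<comment> \<open>A lexicographic key: the stage dominates because \<open>idx\<close> stays below
    \<open>CARD('n)\<close>, which breaks ties injectively. Counting smaller keys afterwards
    compresses the range to an initial segment.\<close>
  define key where "key a = stage a * CARD('n) + idx a" for a
  have key_less: "key a < key b" if "stage a < stage b" for a b
  proof -
    have "key a < Suc (stage a) * CARD('n)" using lt[of a] by (simp add: key_def)
    also have "\<dots> \<le> stage b * CARD('n)" using that by (intro mult_le_mono1) simp
    finally show ?thesis by (simp add: key_def)
  qed
  have key_inj: "a = b" if "key a = key b" for a b
  proof -
    have "stage a = stage b" using key_less[of a b] key_less[of b a] that by (metis less_irrefl linorder_neqE_nat)
    with that have "idx a = idx b" by (simp add: key_def)
    with idx show ?thesis by (auto simp: bij_betw_def inj_on_def)
  qed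
  define r where "r a = card {b. key b < key a}" for a
  have r_less: "r a < r b" if "key a < key b" for a b
    unfolding r_def using that by (intro psubset_card_mono) auto
  have "inj r" using r_less key_inj by (intro injI) (metis less_irrefl linorder_neqE_nat)
  moreover have "r a < CARD('n)" for a
    unfolding r_def by (intro psubset_card_mono) auto
  then have "range r = {..<CARD('n)}"
    using \<open>inj r\<close> by (intro card_subset_eq) (auto simp: card_image)
  ultimately show thesis using that r_less key_less by blast
qed

theorem theorem7:
  fixes M :: "'a measure"
    and F :: "nat \<Rightarrow> 'a measure"
    and T :: nat
    and n :: "nat \<Rightarrow> nat"
    and stage :: "'n::finite \<Rightarrow> nat"
    and h :: "real ^ 'n \<Rightarrow> 'a \<Rightarrow> ereal"
    and m :: "'a \<Rightarrow> real"
    and N :: "'a \<Rightarrow> (real ^ 'n) set"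
  assumes "complete_filtered_prob_space M F T"
    and "block_decomposition T n stage"
    and "normal_integrand M h"
    and "integrable M m"
    and "AE \<omega> in M. \<forall>x. ereal (m \<omega>) \<le> h x \<omega>"
    and "measurable_set_valued M N"
    and "\<forall>\<omega>\<in>space M. subspace (N \<omega>)"
    and "{x \<in> adapted_strategies F stage. AE \<omega> in M. horizon (\<lambda>y. h y \<omega>) (x \<omega>) \<le> 0} =
         {x \<in> adapted_strategies F stage. AE \<omega> in M. x \<omega> \<in> N \<omega>}"
    and "\<forall>x\<in>adapted_strategies F stage. \<forall>x'\<in>adapted_strategies F stage.
           (AE \<omega> in M. x' \<omega> \<in> N \<omega>) \<longrightarrow>
           integral_functional M h (\<lambda>\<omega>. x \<omega> + x' \<omega>) = integral_functional M h x"
  shows "\<exists>x\<in>adapted_strategies F stage. integral_functional M h x =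
           (INF x'\<in>adapted_strategies F stage. integral_functional M h x')"
proof -
  interpret S: complete_filtered_prob_space M F T by fact
  obtain r :: "'n \<Rightarrow> nat" where r: "inj r" "range r = {..<CARD('n)}"
    and r_stage: "\<And>a b. stage a < stage b \<Longrightarrow> r a < r b"
    using ex_stage_ranking[of stage] by blast
  have stage_T: "stage a \<le> T" for a using assms(2) by (simp add: block_decomposition_def)
  \<comment> \<open>Refinement of the stages by \<open>r\<close> makes this family increasing, and
    the value \<open>M\<close> from rank \<open>CARD('n)\<close> on gives full information at the
    base of the induction.\<close>
  define G where "G i = (if i < CARD('n) then F (stage (inv r i)) else M)" for i
  have r_lt: "r c < CARD('n)" for c using r(2) by auto
  have G_r: "G (r c) = F (stage c)" for c using r(1) r_lt by (simp add: G_def)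
  have adapted: "adapted_strategies G r = adapted_strategies F stage"
    by (simp add: adapted_strategies_def G_r)
  have subalg: "subalgebra M (G i)" for i
    using S.subalgebra_F[OF stage_T] by (auto simp: G_def subalgebra_def)
  have G_mono: "sets (G i) \<subseteq> sets (G j)" if "i \<le> j" for i j
  proof (cases "j < CARD('n)")
    case True
    with that r(2) obtain a b where ab: "i = r a" "j = r b"
      by (metis imageE lessThan_iff order.strict_trans1)
    then have "stage a \<le> stage b" using r_stage[of b a] that by linarith
    with ab show ?thesis by (simp add: G_r S.sets_F_mono stage_T)
  next
    case False
    then show ?thesis using subalg[of i] by (simp add: G_def[of j] subalgebra_def)
  qed
  have h_meas: "(\<lambda>\<omega>. h (x \<omega>) \<omega>) \<in> borel_measurable M" if [measurable]: "x \<in> borel_measurable M" for x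
  proof -
    have "(\<lambda>\<omega>. (\<lambda>(x, \<omega>). h x \<omega>) (x \<omega>, \<omega>)) \<in> borel_measurable M"
      by (rule measurable_compose[where N="borel \<Otimes>\<^sub>M M"]) (use assms(3) in \<open>auto simp: normal_integrand_def\<close>)
    then show ?thesis by simp
  qed
  have lsc: "lower_semicontinuous (\<lambda>x. h x \<omega>)" if "\<omega> \<in> space M" for \<omega>
    using assms(3) that by (simp add: normal_integrand_def)
  have [measurable]: "m \<in> borel_measurable M" using assms(4) by simp
  \<comment> \<open>Truncation at zero changes values only on the null set where the lower bound
    fails, and it preserves semicontinuity at every \<omega>. In \<open>H\<close> below, it turns
    the condition of a nonpositive horizon function into vanishing of \<open>H\<close>.\<close>
  define f where "f x \<omega> = e2ennreal (ereal (- m \<omega>) + h x \<omega>)" for x \<omega>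
  define H where "H w \<omega> = e2ennreal (horizon (\<lambda>y. h y \<omega>) w)" for w \<omega>
  have measM: "x \<in> borel_measurable M" if "x \<in> adapted_strategies F stage" for x :: "'a \<Rightarrow> real ^ 'n"
    using that measurable_from_subalg[OF subalg, of _ "r _"]
    by (intro borel_measurable_vec_components) (auto simp: adapted_strategies_def G_r)
  have E: "integral_functional M h x = enn2ereal (\<integral>\<^sup>+\<omega>. f (x \<omega>) \<omega> \<partial>M) + ereal (\<integral>\<omega>. m \<omega> \<partial>M)"
    if "x \<in> adapted_strategies F stage" for x
    unfolding integral_functional_def f_def
  proof (rule ereal_expectation_shift)
    show "AE \<omega> in M. ereal (m \<omega>) \<le> h (x \<omega>) \<omega>" using assms(5) by eventually_elim simp
  qed (use assms(4) h_meas measM that in auto)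
  interpret R: recession_program M G r "CARD('n)" f H N
  proof
    show "(\<lambda>\<omega>. f (x \<omega>) \<omega>) \<in> borel_measurable M" if "x \<in> borel_measurable M" for x
      using h_meas[OF that] unfolding f_def by measurable
    show "f y \<omega> \<le> liminf (\<lambda>k. f (z k) \<omega>)" if "\<omega> \<in> space M" "z \<longlonglongrightarrow> y" for \<omega> z y
    proof -
      have "ereal (- m \<omega>) + h y \<omega> \<le> ereal (- m \<omega>) + liminf (\<lambda>k. h (z k) \<omega>)"
        by (intro add_left_mono lower_semicontinuous_liminf lsc that)
      also have "\<dots> = liminf (\<lambda>k. ereal (- m \<omega>) + h (z k) \<omega>)"
        by (rule ereal_liminf_lim_add[symmetric]) auto
      finally show ?thesis unfolding f_def e2ennreal_liminf[symmetric] by (rule e2ennreal_mono)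
    qed
    show "H w \<omega> \<le> liminf (\<lambda>k. ennreal (l k) * f (z k) \<omega>)"
      if "\<omega> \<in> space M" and pos: "\<And>k. 0 < l k" and l: "l \<longlonglongrightarrow> 0" and z: "(\<lambda>k. l k *\<^sub>R z k) \<longlonglongrightarrow> w"
      for \<omega> l z w
    proof -
      \<comment> \<open>The shift by \<open>m \<omega>\<close> is a finite constant at fixed
        \<omega>, so scaling by \<open>l k\<close> removes it and \<open>f\<close> has the recession
        behaviour of \<open>h\<close>.\<close>
      have "(\<lambda>k. - (l k * m \<omega>)) \<longlonglongrightarrow> 0" using tendsto_minus[OF tendsto_mult_right[OF l]] by simp
      then have 0: "(\<lambda>k. ereal (- (l k * m \<omega>))) \<longlonglongrightarrow> 0" by (simp add: zero_ereal_def)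
      have "horizon (\<lambda>y. h y \<omega>) w \<le> 0 + liminf (\<lambda>k. ereal (l k) * h (z k) \<omega>)"
        using horizon_le_liminf[OF pos l z, of "\<lambda>y. h y \<omega>"] by simp
      also have "\<dots> = liminf (\<lambda>k. ereal (- (l k * m \<omega>)) + ereal (l k) * h (z k) \<omega>)"
        by (rule ereal_liminf_lim_add[OF 0, symmetric]) simp
      also have "(\<lambda>k. ereal (- (l k * m \<omega>)) + ereal (l k) * h (z k) \<omega>) =
          (\<lambda>k. ereal (l k) * (ereal (- m \<omega>) + h (z k) \<omega>))"
      proof
        fix k
        show "ereal (- (l k * m \<omega>)) + ereal (l k) * h (z k) \<omega> = ereal (l k) * (ereal (- m \<omega>) + h (z k) \<omega>)"
          using pos[of k] by (cases "h (z k) \<omega>") (auto simp: algebra_simps)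
      qed
      finally show ?thesis
        unfolding H_def f_def ennreal_mult_e2ennreal[OF pos] e2ennreal_liminf[symmetric] by (rule e2ennreal_mono)
    qed
    show "AE \<omega> in M. H 0 \<omega> = 0"
    proof -
      \<comment> \<open>The assumed equality of sets is read from right to left here: the zero
        strategy lies in \<open>N\<close>, hence the horizon function is nonpositive at zero.
        \<open>recession_N\<close> uses the other inclusion.\<close>
      have "(\<lambda>_. 0) \<in> {x \<in> adapted_strategies F stage. AE \<omega> in M. x \<omega> \<in> N \<omega>}"
        using assms(7) by (auto simp: adapted_strategies_def intro: subspace_0)
      then show ?thesis unfolding assms(8)[symmetric] by (simp add: H_def e2ennreal_eq_0_iff)
    qed
    show "AE \<omega> in M. w \<omega> \<in> N \<omega>" if "w \<in> adapted_strategies G r" "AE \<omega> in M. H (w \<omega>) \<omega> = 0" for w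
    proof -
      have "w \<in> {x \<in> adapted_strategies F stage. AE \<omega> in M. horizon (\<lambda>y. h y \<omega>) (x \<omega>) \<le> 0}"
        using that by (simp add: adapted H_def e2ennreal_eq_0_iff)
      then show ?thesis unfolding assms(8) by simp
    qed
    show "(\<integral>\<^sup>+\<omega>. f (x \<omega> + w \<omega>) \<omega> \<partial>M) = (\<integral>\<^sup>+\<omega>. f (x \<omega>) \<omega> \<partial>M)"
      if "x \<in> adapted_strategies G r" "w \<in> adapted_strategies G r" "AE \<omega> in M. w \<omega> \<in> N \<omega>" for x w
    proof -
      have xw: "(\<lambda>\<omega>. x \<omega> + w \<omega>) \<in> adapted_strategies F stage"
        using that unfolding adapted by (auto simp: adapted_strategies_def intro!: borel_measurable_add)
      have "integral_functional M h (\<lambda>\<omega>. x \<omega> + w \<omega>) = integral_functional M h x"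
        using assms(9) that by (simp add: adapted)
      \<comment> \<open>Both sides carry the same finite summand, the integral of \<open>m\<close>,
        so it may be cancelled even if the costs are infinite.\<close>
      then show ?thesis using E[OF xw] E[of x] that(1)
        by (simp add: adapted ereal_add_cancel_right enn2ereal_inject)
    qed
  qed (use subalg G_mono r assms(7) in \<open>auto simp: G_def[of "CARD('n)"]\<close>)
  obtain y where y: "y \<in> adapted_strategies F stage"
    and min: "(\<integral>\<^sup>+\<omega>. f (y \<omega>) \<omega> \<partial>M) = (INF x\<in>adapted_strategies F stage. \<integral>\<^sup>+\<omega>. f (x \<omega>) \<omega> \<partial>M)"
    using R.ex_minimizer unfolding adapted by blast
  have "integral_functional M h y \<le> integral_functional M h x" if "x \<in> adapted_strategies F stage" for x
    unfolding E[OF y] E[OF that] min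
    using INF_lower[OF that, of "\<lambda>x. \<integral>\<^sup>+\<omega>. f (x \<omega>) \<omega> \<partial>M"]
    by (intro add_right_mono) (simp add: less_eq_ennreal.rep_eq)
  with y show ?thesis
    by (intro bexI[of _ y] antisym INF_greatest INF_lower) auto
qed

end
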